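(* Let $U_h^0,U_h^1,\dots,U_h^N\in V_h$ satisfy the fully discrete finite element scheme: for every $n=1,2,\dots,N-1$ and every $v_h\in V_h$, $$(\delta_\tau^2U_h^n,v_h)+(\nabla U_h^{\overline n},\nabla v_h)+\mathbf i(D_\tau U_h^n,v_h)+\left(|U_h^n|^2U_h^{\overline n},v_h\right)+(wU_h^{\overline n},v_h)=0,$$ with $$U_h^0=R_hu_0,\qquad U_h^1=R_h\left(u_0+\tau u_1+\tfrac{\tau^2}{2}\left(\Delta u_0-\mathbf i u_1-|u_0|^2u_0-wu_0\right)\right).$$ For $0\le n\le N-1$ define the discrete energy $$E^n=\left\|\frac{U_h^{n+1}-U_h^n}{\tau}\right\|_{L^2}^2+\frac12\left(\|\nabla U_h^{n+1}\|_{L^2}^2+\|\nabla U_h^n\|_{L^2}^2\right)+\frac{\|U_h^nU_h^{n+1}\|_{L^2}^2}{2}+\frac{(wU_h^n,U_h^n)+(wU_h^{n+1},U_h^{n+1})}{2}.$$ Then the discrete energy is conserved: $$E^{N-1}=E^{N-2}=\cdots=E^1=E^0.$$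
   Context: $\Omega$ is a convex polygon in $\mathbb R^2$ ($d=2$) or a convex polyhedron in $\mathbb R^3$ ($d=3$). $\mathcal T_h$ is a quasi-uniform partition of $\Omega$ into triangles (resp. tetrahedra) with mesh size $h$, the maximum diameter of its elements. $V_h\subset H_0^1(\Omega)$ is the finite-dimensional space of continuous piecewise polynomials of degree $r$ ($r\ge1$) on $\mathcal T_h$; functions are complex-valued. The inner product is $(u,v)=\int_\Omega u\,v^*\,dx$, with $v^*$ the complex conjugate. $\mathbf i=\sqrt{-1}$. The Ritz projection $R_h:H_0^1(\Omega)\to V_h$ is defined by $(\nabla(v-R_hv),\nabla\omega)=0$ for all $\omega\in V_h$. $T>0$, $N$ is a positive integer, $\tau=T/N$, $t_n=n\tau$. For a sequence $(U^n)$, $$\delta_\tau^2U^n=\frac{U^{n+1}-2U^n+U^{n-1}}{\tau^2},\quad D_\tau U^n=\frac{U^{n+1}-U^{n-1}}{2\tau},\quad U^{\overline n}=\frac{U^{n-1}+U^{n+1}}{2}.$$ $w$ is a real-valued potential function on $\Omega$, $w\in H^{r+1}(\Omega)$. $u_0,u_1$ are given (complex-valued) initial data, regular enough that $u_0$ and $u_0+\tau u_1+\frac{\tau^2}{2}(\Delta u_0-\mathbf i u_1-|u_0|^2u_0-wu_0)$ lie in $H_0^1(\Omega)$. *)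

theory Defs
  imports "HOL-Analysis.Analysis"
begin

section \<open>Lebesgue spaces and weak derivatives\<close>

text \<open>
  Elements of function spaces over a domain are represented by functions on the whole of
  \<open>real ^ 'n\<close>; only their values on the domain, up to null sets, matter.
\<close>

definition loc_integrable :: "(real ^ 'n) set \<Rightarrow> (real ^ 'n \<Rightarrow> complex) \<Rightarrow> bool" where
  "loc_integrable \<Omega> f \<longleftrightarrow> (\<forall>K. compact K \<and> K \<subseteq> \<Omega> \<longrightarrow> set_integrable lebesgue K f)"

definition L2 :: "(real ^ 'n) set \<Rightarrow> (real ^ 'n \<Rightarrow> complex) set" where
  "L2 \<Omega> = {f. f \<in> borel_measurable (lebesgue_on \<Omega>) \<and>
               set_integrable lebesgue \<Omega> (\<lambda>x. (cmod (f x))\<^sup>2)}"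

definition l2_inner ::
  "(real ^ 'n) set \<Rightarrow> (real ^ 'n \<Rightarrow> complex) \<Rightarrow> (real ^ 'n \<Rightarrow> complex) \<Rightarrow> complex" where
  "l2_inner \<Omega> u v = set_lebesgue_integral lebesgue \<Omega> (\<lambda>x. u x * cnj (v x))"

definition l2_inner_vec ::
  "(real ^ 'n) set \<Rightarrow> (real ^ 'n \<Rightarrow> complex ^ 'n) \<Rightarrow> (real ^ 'n \<Rightarrow> complex ^ 'n) \<Rightarrow> complex" where
  "l2_inner_vec \<Omega> F G = set_lebesgue_integral lebesgue \<Omega> (\<lambda>x. \<Sum>i\<in>UNIV. F x $ i * cnj (G x $ i))"

text \<open>Used for scalar functions and, with the Euclidean norm of \<open>complex ^ 'n\<close>, for gradients.\<close>

definition l2_norm :: "(real ^ 'n) set \<Rightarrow> (real ^ 'n \<Rightarrow> 'b::real_normed_vector) \<Rightarrow> real" where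
  "l2_norm \<Omega> f = sqrt (set_lebesgue_integral lebesgue \<Omega> (\<lambda>x. (norm (f x))\<^sup>2))"

text \<open>
  A multi-index is encoded as the list of coordinate directions in which one differentiates;
  its order is the length of the list.
\<close>

fun iter_partial :: "'n list \<Rightarrow> (real ^ 'n \<Rightarrow> complex) \<Rightarrow> real ^ 'n \<Rightarrow> complex" where
  "iter_partial [] f = f"
| "iter_partial (i # \<alpha>) f = (\<lambda>x. frechet_derivative (iter_partial \<alpha> f) (at x) (axis i 1))"

definition smooth_fun :: "(real ^ 'n \<Rightarrow> complex) \<Rightarrow> bool" where
  "smooth_fun f \<longleftrightarrow> (\<forall>\<alpha> x. iter_partial \<alpha> f differentiable (at x))"

definition test_functions :: "(real ^ 'n) set \<Rightarrow> (real ^ 'n \<Rightarrow> complex) set" where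
  "test_functions \<Omega> = {\<phi>. smooth_fun \<phi> \<and> compact (closure {x. \<phi> x \<noteq> 0}) \<and>
                          closure {x. \<phi> x \<noteq> 0} \<subseteq> \<Omega>}"

definition is_weak_deriv ::
  "(real ^ 'n) set \<Rightarrow> 'n list \<Rightarrow> (real ^ 'n \<Rightarrow> complex) \<Rightarrow> (real ^ 'n \<Rightarrow> complex) \<Rightarrow> bool" where
  "is_weak_deriv \<Omega> \<alpha> u g \<longleftrightarrow> loc_integrable \<Omega> u \<and> loc_integrable \<Omega> g \<and>
     (\<forall>\<phi>\<in>test_functions \<Omega>.
        set_lebesgue_integral lebesgue \<Omega> (\<lambda>x. u x * iter_partial \<alpha> \<phi> x) =
        (-1) ^ length \<alpha> * set_lebesgue_integral lebesgue \<Omega> (\<lambda>x. g x * \<phi> x))"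

text \<open>
  Weak derivatives on an open set are unique up to null sets, so the representative selected
  here does not affect any of the integrals in which it is used.
\<close>

definition weak_deriv ::
  "(real ^ 'n) set \<Rightarrow> 'n list \<Rightarrow> (real ^ 'n \<Rightarrow> complex) \<Rightarrow> real ^ 'n \<Rightarrow> complex" where
  "weak_deriv \<Omega> \<alpha> u = (SOME g. is_weak_deriv \<Omega> \<alpha> u g)"

definition weak_grad ::
  "(real ^ 'n) set \<Rightarrow> (real ^ 'n \<Rightarrow> complex) \<Rightarrow> real ^ 'n \<Rightarrow> complex ^ 'n" where
  "weak_grad \<Omega> u x = (\<chi> i. weak_deriv \<Omega> [i] u x)"

definition is_weak_laplacian ::
  "(real ^ 'n) set \<Rightarrow> (real ^ 'n \<Rightarrow> complex) \<Rightarrow> (real ^ 'n \<Rightarrow> complex) \<Rightarrow> bool" where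
  "is_weak_laplacian \<Omega> u g \<longleftrightarrow> loc_integrable \<Omega> u \<and> loc_integrable \<Omega> g \<and>
     (\<forall>\<phi>\<in>test_functions \<Omega>.
        set_lebesgue_integral lebesgue \<Omega> (\<lambda>x. u x * (\<Sum>i\<in>UNIV. iter_partial [i, i] \<phi> x)) =
        set_lebesgue_integral lebesgue \<Omega> (\<lambda>x. g x * \<phi> x))"

definition weak_laplacian ::
  "(real ^ 'n) set \<Rightarrow> (real ^ 'n \<Rightarrow> complex) \<Rightarrow> real ^ 'n \<Rightarrow> complex" where
  "weak_laplacian \<Omega> u = (SOME g. is_weak_laplacian \<Omega> u g)"


section \<open>Sobolev spaces\<close>

definition sobolev :: "nat \<Rightarrow> (real ^ 'n) set \<Rightarrow> (real ^ 'n \<Rightarrow> complex) set" where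
  "sobolev k \<Omega> = {u. u \<in> L2 \<Omega> \<and> (\<forall>\<alpha>. length \<alpha> \<le> k \<longrightarrow> (\<exists>g\<in>L2 \<Omega>. is_weak_deriv \<Omega> \<alpha> u g))}"

definition h1_norm :: "(real ^ 'n) set \<Rightarrow> (real ^ 'n \<Rightarrow> complex) \<Rightarrow> real" where
  "h1_norm \<Omega> u = sqrt ((l2_norm \<Omega> u)\<^sup>2 + (l2_norm \<Omega> (weak_grad \<Omega> u))\<^sup>2)"

definition H10 :: "(real ^ 'n) set \<Rightarrow> (real ^ 'n \<Rightarrow> complex) set" where
  "H10 \<Omega> = {u \<in> sobolev 1 \<Omega>. \<forall>\<epsilon>>0. \<exists>\<phi>\<in>test_functions \<Omega>. h1_norm \<Omega> (\<lambda>x. u x - \<phi> x) < \<epsilon>}"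


section \<open>Polyhedral domains, meshes and finite elements\<close>

definition convex_polyhedral_domain :: "(real ^ 'n) set \<Rightarrow> bool" where
  "convex_polyhedral_domain \<Omega> \<longleftrightarrow> \<Omega> \<noteq> {} \<and> (\<exists>P. polytope P \<and> \<Omega> = interior P)"

definition simplicial_partition :: "(real ^ 'n) set \<Rightarrow> (real ^ 'n) set set \<Rightarrow> bool" where
  "simplicial_partition \<Omega> \<T> \<longleftrightarrow>
     triangulation \<T> \<and> (\<forall>K\<in>\<T>. int CARD('n) simplex K) \<and> \<Union>\<T> = closure \<Omega>"

definition mesh_size :: "(real ^ 'n) set set \<Rightarrow> real" where
  "mesh_size \<T> = Max (diameter ` \<T>)"

text \<open>
  Quasi-uniformity is a property of a family of meshes, indexed by the mesh sizes \<open>h \<in> H\<close>: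
  every element contains a ball of radius at least \<open>\<rho> * h\<close>, with \<open>\<rho>\<close> independent of \<open>h\<close>.
\<close>

definition quasi_uniform_meshes ::
  "(real ^ 'n) set \<Rightarrow> real set \<Rightarrow> (real \<Rightarrow> (real ^ 'n) set set) \<Rightarrow> bool" where
  "quasi_uniform_meshes \<Omega> H \<T> \<longleftrightarrow>
     (\<forall>h\<in>H. simplicial_partition \<Omega> (\<T> h) \<and> mesh_size (\<T> h) = h) \<and>
     (\<exists>\<rho>>0. \<forall>h\<in>H. \<forall>K\<in>\<T> h. \<exists>x. ball x (\<rho> * h) \<subseteq> K)"

definition poly_fun :: "nat \<Rightarrow> (real ^ 'n \<Rightarrow> complex) \<Rightarrow> bool" where
  "poly_fun r p \<longleftrightarrow> (\<exists>c :: ('n \<Rightarrow> nat) \<Rightarrow> complex. \<forall>x.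
     p x = (\<Sum>\<alpha>\<in>{\<alpha>. (\<Sum>i\<in>UNIV. \<alpha> i) \<le> r}. c \<alpha> * of_real (\<Prod>i\<in>UNIV. (x $ i) ^ \<alpha> i)))"

text \<open>
  Continuity on the closed domain together with the value 0 outside it selects exactly one
  representative of each finite element function, so the space is finite-dimensional as a
  set of functions.
\<close>

definition fe_space ::
  "(real ^ 'n) set \<Rightarrow> nat \<Rightarrow> (real ^ 'n) set set \<Rightarrow> (real ^ 'n \<Rightarrow> complex) set" where
  "fe_space \<Omega> r \<T> = {v \<in> H10 \<Omega>. continuous_on (closure \<Omega>) v \<and> (\<forall>x. x \<notin> closure \<Omega> \<longrightarrow> v x = 0) \<and>
     (\<forall>K\<in>\<T>. \<exists>p. poly_fun r p \<and> (\<forall>x\<in>K. v x = p x))}"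

definition ritz_projection ::
  "(real ^ 'n) set \<Rightarrow> (real ^ 'n \<Rightarrow> complex) set \<Rightarrow> (real ^ 'n \<Rightarrow> complex) \<Rightarrow> real ^ 'n \<Rightarrow> complex" where
  "ritz_projection \<Omega> V v = (THE R. R \<in> V \<and>
     (\<forall>\<omega>\<in>V. l2_inner_vec \<Omega> (weak_grad \<Omega> (\<lambda>x. v x - R x)) (weak_grad \<Omega> \<omega>) = 0))"


section \<open>Time discretisation\<close>

text \<open>These operators are only meant for \<open>n \<ge> 1\<close>, because of the truncated \<open>n - 1\<close>.\<close>

definition second_diff :: "real \<Rightarrow> (nat \<Rightarrow> 'a \<Rightarrow> complex) \<Rightarrow> nat \<Rightarrow> 'a \<Rightarrow> complex" where
  "second_diff \<tau> U n x = (U (n + 1) x - 2 * U n x + U (n - 1) x) / of_real (\<tau>\<^sup>2)"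

definition central_diff :: "real \<Rightarrow> (nat \<Rightarrow> 'a \<Rightarrow> complex) \<Rightarrow> nat \<Rightarrow> 'a \<Rightarrow> complex" where
  "central_diff \<tau> U n x = (U (n + 1) x - U (n - 1) x) / of_real (2 * \<tau>)"

definition time_avg :: "(nat \<Rightarrow> 'a \<Rightarrow> complex) \<Rightarrow> nat \<Rightarrow> 'a \<Rightarrow> complex" where
  "time_avg U n x = (U (n - 1) x + U (n + 1) x) / 2"

definition first_step_data ::
  "(real ^ 'n) set \<Rightarrow> real \<Rightarrow> (real ^ 'n \<Rightarrow> real) \<Rightarrow> (real ^ 'n \<Rightarrow> complex) \<Rightarrow>
   (real ^ 'n \<Rightarrow> complex) \<Rightarrow> real ^ 'n \<Rightarrow> complex" where
  "first_step_data \<Omega> \<tau> w u0 u1 x =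
     u0 x + of_real \<tau> * u1 x +
     of_real (\<tau>\<^sup>2 / 2) * (weak_laplacian \<Omega> u0 x - \<i> * u1 x
       - of_real ((cmod (u0 x))\<^sup>2) * u0 x - of_real (w x) * u0 x)"

text \<open>
  Complex-valued because the potential term is an \<open>l2_inner\<close>, which is real only
  as a consequence of \<open>w\<close> being real-valued.
\<close>

definition discrete_energy ::
  "(real ^ 'n) set \<Rightarrow> real \<Rightarrow> (real ^ 'n \<Rightarrow> real) \<Rightarrow> (nat \<Rightarrow> real ^ 'n \<Rightarrow> complex) \<Rightarrow> nat \<Rightarrow> complex" where
  "discrete_energy \<Omega> \<tau> w U n =
     of_real ((l2_norm \<Omega> (\<lambda>x. (U (n + 1) x - U n x) / of_real \<tau>))\<^sup>2)
   + of_real (1 / 2 * ((l2_norm \<Omega> (weak_grad \<Omega> (U (n + 1))))\<^sup>2 + (l2_norm \<Omega> (weak_grad \<Omega> (U n)))\<^sup>2))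
   + of_real ((l2_norm \<Omega> (\<lambda>x. U n x * U (n + 1) x))\<^sup>2 / 2)
   + (l2_inner \<Omega> (\<lambda>x. of_real (w x) * U n x) (U n)
      + l2_inner \<Omega> (\<lambda>x. of_real (w x) * U (n + 1) x) (U (n + 1))) / 2"

end

theory Submission
  imports Defs "HOL-Computational_Algebra.Polynomial"
begin

text \<open>
  Write \<open>a\<close>, \<open>b\<close>, \<open>c\<close> for three consecutive time levels \<open>U (n + 1)\<close>, \<open>U n\<close>, \<open>U (n - 1)\<close>. Test the
  scheme with \<open>a - c\<close> and take real parts. Every term then becomes a difference of two terms of the
  energy, by a pointwise identity for complex numbers: the second difference gives
  \<open>\<bar>a - b\<bar>\<^sup>2 - \<bar>b - c\<bar>\<^sup>2\<close> since \<open>a - 2 b + c = (a - b) - (b - c)\<close> and \<open>a - c = (a - b) + (b - c)\<close>; the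
  time averages give \<open>(\<bar>a\<bar>\<^sup>2 - \<bar>c\<bar>\<^sup>2) / 2\<close> times the real weights \<open>1\<close>, \<open>\<bar>b\<bar>\<^sup>2\<close> and \<open>w\<close>; and the
  first-order term is \<open>\<i>\<close> times a real number, so it drops out. The sum of these differences is
  the energy at level \<open>n\<close> minus the energy at level \<open>n - 1\<close>; this is \<open>discrete_energy_step\<close>.

  Formally the scheme is tested with \<open>a\<close> and with \<open>c\<close>, and the two equations are subtracted; this
  avoids showing that \<open>H10\<close>, and with it the finite element space, is closed under differences.
  The finite element space enters through two properties: its members lie in the Sobolev space
  of order one and are bounded on the domain.

  The analytic substance is in the gradient term. \<open>weak_deriv\<close> is a choice of some weak
  derivative, so both its square integrability and the identity
  \<open>\<nabla> ((a + c) / 2) = (\<nabla> a + \<nabla> c) / 2\<close> hold only almost everywhere and rest on uniqueness of weak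
  derivatives (\<open>is_weak_deriv_unique_AE\<close>), that is, on the fundamental lemma of the calculus of
  variations: a locally integrable function orthogonal to all test functions vanishes almost
  everywhere. To prove it, smooth bumps that increase to the indicator of a box show that the
  function has integral zero over every box whose closure lies in the domain, and boxes generate
  the Borel sets.
\<close>

section \<open>Smooth bumps approximating the indicator of a box\<close>

text \<open>
  The classical function \<open>exp (- 1 / t)\<close>, which vanishes to infinite order at \<open>0\<close>. The factor
  \<open>p (1 / t)\<close> makes the family closed under differentiation.
\<close>

definition flat :: "real poly \<Rightarrow> real \<Rightarrow> real" where
  "flat p t = (if t > 0 then poly p (inverse t) * exp (- inverse t) else 0)"

lemma poly_times_exp_minus_tendsto_0: "((\<lambda>s. poly p s * exp (- s)) \<longlongrightarrow> 0) (at_top :: real filter)"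
proof -
  have "((\<lambda>s. \<Sum>i\<le>degree p. coeff p i * (s ^ i / exp s)) \<longlongrightarrow> (\<Sum>i\<le>degree p. coeff p i * 0)) (at_top :: real filter)"
    by (intro tendsto_intros tendsto_power_div_exp_0)
  moreover have "(\<lambda>s. \<Sum>i\<le>degree p. coeff p i * (s ^ i / exp s)) = (\<lambda>s. poly p s * exp (- s))"
    by (simp add: fun_eq_iff poly_altdef sum_distrib_right exp_minus divide_inverse mult.assoc)
  ultimately show ?thesis by simp
qed

lemma flat_has_derivative:
  "(flat p has_real_derivative flat ([:0, 0, 1:] * (p - pderiv p)) t) (at t)"
proof -
  consider "t > 0" | "t < 0" | "t = 0" by linarith
  then show ?thesis
  proof cases
    case 1
    have ev: "\<forall>\<^sub>F s in nhds t. poly p (inverse s) * exp (- inverse s) = flat p s"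
      using eventually_nhds_in_open[of "{0<..}" t] 1
      by (auto elim!: eventually_mono simp: flat_def)
    have inv: "(inverse has_real_derivative - (inverse t ^ 2)) (at t)"
      using DERIV_inverse[of t UNIV] 1 by (simp add: numeral_2_eq_2)
    have "((\<lambda>s. exp (- inverse s)) has_real_derivative exp (- inverse t) * inverse t ^ 2) (at t)"
      using DERIV_chain2[OF DERIV_exp DERIV_minus[OF inv]] by simp
    from DERIV_mult[OF DERIV_chain2[OF poly_DERIV inv] this]
    have "((\<lambda>s. poly p (inverse s) * exp (- inverse s)) has_real_derivative
        flat ([:0, 0, 1:] * (p - pderiv p)) t) (at t)"
      by (rule DERIV_cong) (use 1 in \<open>simp add: flat_def power2_eq_square ring_distribs mult_ac\<close>)
    then show ?thesis
      by (rule DERIV_cong_ev[OF refl ev refl, THEN iffD1])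
  next
    case 2
    have ev: "\<forall>\<^sub>F s in nhds t. (\<lambda>_. 0) s = flat p s"
      using eventually_nhds_in_open[of "{..<0}" t] 2
      by (auto elim!: eventually_mono simp: flat_def)
    have "((\<lambda>_. 0) has_real_derivative flat ([:0, 0, 1:] * (p - pderiv p)) t) (at t)"
      using 2 by (simp add: flat_def)
    then show ?thesis
      by (rule DERIV_cong_ev[OF refl ev refl, THEN iffD1])
  next
    case 3
    have L: "((\<lambda>s. (flat p s - flat p 0) / (s - 0)) \<longlongrightarrow> 0) (at_left 0)"
    proof (rule Lim_transform_eventually)
      show "\<forall>\<^sub>F s in at_left 0. 0 = (flat p s - flat p 0) / (s - 0)"
        by (auto simp: eventually_at_left_field flat_def intro: exI[of _ "-1"])
    qed simp
    \<comment> \<open>The difference quotient at \<open>0\<close> is a function of the same form, with \<open>p\<close> multiplied by the variable.\<close>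
    have "((\<lambda>s. poly ([:0, 1:] * p) (inverse s) * exp (- inverse s)) \<longlongrightarrow> 0) (at_right 0)"
      by (rule filterlim_compose[OF poly_times_exp_minus_tendsto_0 filterlim_inverse_at_top_right])
    then have R: "((\<lambda>s. (flat p s - flat p 0) / (s - 0)) \<longlongrightarrow> 0) (at_right 0)"
    proof (rule Lim_transform_eventually)
      show "\<forall>\<^sub>F s in at_right 0. poly ([:0, 1:] * p) (inverse s) * exp (- inverse s)
          = (flat p s - flat p 0) / (s - 0)"
        by (auto simp: eventually_at_right_field flat_def divide_inverse intro: exI[of _ "1"])
    qed
    from L R have "((\<lambda>s. (flat p s - flat p 0) / (s - 0)) \<longlongrightarrow> 0) (at 0)"
      by (rule filterlim_split_at)
    then show ?thesis
      using 3 by (simp add: has_field_derivative_iff flat_def)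
  qed
qed

text \<open>
  Smoothness here is differentiability of all iterated partial derivatives, so it follows for
  every member of a class of differentiable functions that is closed under partial derivatives.
  The bumps below are products of its generators, with \<open>s > 0\<close> at a lower face of the box and
  \<open>s < 0\<close> at an upper one.
\<close>

inductive_set flat_algebra :: "(real ^ 'n \<Rightarrow> complex) set" where
  const: "(\<lambda>x. c) \<in> flat_algebra"
| flat: "(\<lambda>x. of_real (flat p (s * x $ i + t))) \<in> flat_algebra"
| add: "f \<in> flat_algebra \<Longrightarrow> g \<in> flat_algebra \<Longrightarrow> (\<lambda>x. f x + g x) \<in> flat_algebra"
| mult: "f \<in> flat_algebra \<Longrightarrow> g \<in> flat_algebra \<Longrightarrow> (\<lambda>x. f x * g x) \<in> flat_algebra"

lemma flat_algebra_closed_partial: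
  fixes f :: "real ^ 'n \<Rightarrow> complex"
  assumes "f \<in> flat_algebra"
  shows "\<exists>D. (\<forall>x. (f has_derivative D x) (at x)) \<and> (\<forall>i. (\<lambda>x. D x (axis i 1)) \<in> flat_algebra)"
  using assms
proof induction
  case (const c)
  show ?case
    by (rule exI[of _ "\<lambda>x h. 0"]) (auto intro: flat_algebra.const)
next
  case (flat p s i t)
  define q where "q = [:0, 0, 1:] * (p - pderiv p)"
  define D :: "real ^ 'n \<Rightarrow> real ^ 'n \<Rightarrow> complex" where "D = (\<lambda>x h. of_real (flat q (s * x $ i + t) * (s * h $ i)))"
  have "((\<lambda>x. of_real (flat p (s * x $ i + t))) has_derivative D x) (at x)" for x
  proof -
    have "((\<lambda>x. s * x $ i + t) has_derivative (\<lambda>h. s * h $ i)) (at x)"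
      by (auto intro!: derivative_eq_intros bounded_linear_imp_has_derivative bounded_linear_vec_nth)
    moreover have "(flat p has_derivative (\<lambda>h. flat q (s * x $ i + t) * h)) (at (s * x $ i + t))"
      using flat_has_derivative[of p "s * x $ i + t"] by (simp add: has_field_derivative_def q_def)
    ultimately have "((\<lambda>x. flat p (s * x $ i + t)) has_derivative
        (\<lambda>h. flat q (s * x $ i + t) * (s * h $ i))) (at x)"
      by (rule has_derivative_compose)
    then show ?thesis
      unfolding D_def by (rule has_derivative_of_real)
  qed
  moreover have "(\<lambda>x. D x (axis j 1)) \<in> flat_algebra" for j
  proof -
    have "(\<lambda>x. of_real (flat q (s * x $ i + t)) * (\<lambda>_. of_real (s * axis j 1 $ i)) x) \<in> flat_algebra"
      by (intro flat_algebra.intros)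
    then show ?thesis by (simp add: D_def)
  qed
  ultimately show ?case by blast
next
  case (add f g)
  then obtain D E where D: "\<And>x. (f has_derivative D x) (at x)" "\<And>i. (\<lambda>x. D x (axis i 1)) \<in> flat_algebra"
    and E: "\<And>x. (g has_derivative E x) (at x)" "\<And>i. (\<lambda>x. E x (axis i 1)) \<in> flat_algebra"
    by blast
  show ?case
    by (rule exI[of _ "\<lambda>x h. D x h + E x h"])
      (auto intro!: has_derivative_add D E flat_algebra.intros)
next
  case (mult f g)
  then obtain D E where D: "\<And>x. (f has_derivative D x) (at x)" "\<And>i. (\<lambda>x. D x (axis i 1)) \<in> flat_algebra"
    and E: "\<And>x. (g has_derivative E x) (at x)" "\<And>i. (\<lambda>x. E x (axis i 1)) \<in> flat_algebra"
    by blast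
  show ?case
    by (rule exI[of _ "\<lambda>x h. f x * E x h + D x h * g x"])
      (auto intro!: has_derivative_mult D E flat_algebra.intros mult.hyps)
qed

lemma iter_partial_flat_algebra:
  assumes "f \<in> flat_algebra"
  shows "iter_partial \<alpha> f \<in> flat_algebra"
proof (induction \<alpha>)
  case Nil
  then show ?case using assms by simp
next
  case (Cons i \<alpha>)
  obtain D where D: "\<And>x. (iter_partial \<alpha> f has_derivative D x) (at x)"
      "\<And>i. (\<lambda>x. D x (axis i 1)) \<in> flat_algebra"
    using flat_algebra_closed_partial[OF Cons] by blast
  have "frechet_derivative (iter_partial \<alpha> f) (at x) = D x" for x
    using frechet_derivative_at[OF D(1)] by simp
  then show ?case using D(2) by simp
qed

lemma flat_algebra_smooth:
  assumes "f \<in> flat_algebra"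
  shows "smooth_fun f"
  unfolding smooth_fun_def
  using flat_algebra_closed_partial[OF iter_partial_flat_algebra[OF assms]] differentiableI by blast

lemma flat_algebra_prod:
  assumes "\<And>i. i \<in> A \<Longrightarrow> f i \<in> flat_algebra"
  shows "(\<lambda>x. \<Prod>i\<in>A. f i x) \<in> flat_algebra"
  using assms
  by (induction A rule: infinite_finite_induct) (auto intro: flat_algebra.intros)

text \<open>
  On the box each factor is \<open>exp (- 1 / (k s))\<close> with \<open>s\<close> the distance to a face, so the bump is the
  \<open>k\<close>-th root of the bump for \<open>k = 1\<close>. As \<open>k\<close> grows it therefore tends to \<open>1\<close> on the open box, while it
  stays between \<open>0\<close> and \<open>1\<close> and its support does not change.
\<close>

definition bump :: "real \<Rightarrow> real ^ 'n \<Rightarrow> real ^ 'n \<Rightarrow> real ^ 'n \<Rightarrow> real" where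
  "bump k a b x = (\<Prod>i\<in>UNIV. flat 1 (k * (x $ i - a $ i)) * flat 1 (k * (b $ i - x $ i)))"

lemma flat_1_bounds: "0 \<le> flat 1 t" "flat 1 t \<le> 1"
  by (auto simp: flat_def)

lemma bump_bounds: "0 \<le> bump k a b x" "bump k a b x \<le> 1"
  unfolding bump_def
  by (auto intro!: prod_nonneg prod_le_1 mult_nonneg_nonneg mult_le_one flat_1_bounds)

lemma bump_zero_outside:
  assumes "k > 0" "x \<notin> box a b"
  shows "bump k a b x = 0"
proof -
  obtain i where "\<not> (a $ i < x $ i \<and> x $ i < b $ i)"
    using assms(2) by (auto simp: mem_box_cart)
  then have "flat 1 (k * (x $ i - a $ i)) * flat 1 (k * (b $ i - x $ i)) = 0"
    using assms(1) by (auto simp: flat_def zero_less_mult_iff)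
  then show ?thesis
    unfolding bump_def by (intro prod_zero) auto
qed

lemma bump_tendsto_1:
  assumes "x \<in> box a b"
  shows "(\<lambda>n. bump (real (Suc n)) a b x) \<longlonglongrightarrow> 1"
proof -
  have lim: "(\<lambda>n. flat 1 (real (Suc n) * s)) \<longlonglongrightarrow> 1" if "s > 0" for s
  proof -
    have "(\<lambda>n. exp (- (inverse (real (Suc n)) * inverse s))) \<longlonglongrightarrow> exp (- (0 * inverse s))"
      by (intro tendsto_intros LIMSEQ_inverse_real_of_nat)
    then show ?thesis
      using that by (simp add: flat_def zero_less_mult_iff)
  qed
  have "(\<lambda>n. bump (real (Suc n)) a b x) \<longlonglongrightarrow> (\<Prod>i\<in>(UNIV::'a set). 1 * 1)"
    unfolding bump_def using assms
    by (intro tendsto_prod tendsto_mult lim) (auto simp: mem_box_cart)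
  then show ?thesis by simp
qed

lemma bump_test_function:
  assumes "k > 0" "cbox a b \<subseteq> \<Omega>"
  shows "(\<lambda>x. complex_of_real (bump k a b x)) \<in> test_functions \<Omega>"
proof -
  have "(\<lambda>x. \<Prod>i\<in>UNIV. (\<lambda>x. complex_of_real (flat 1 (k * x $ i + - k * a $ i)) *
      of_real (flat 1 ((- k) * x $ i + k * b $ i))) x) \<in> flat_algebra"
    by (intro flat_algebra_prod flat_algebra.mult flat_algebra.flat)
  then have "(\<lambda>x. complex_of_real (bump k a b x)) \<in> flat_algebra"
    by (simp add: bump_def algebra_simps)
  moreover have supp: "closure {x. complex_of_real (bump k a b x) \<noteq> 0} \<subseteq> cbox a b"
    using bump_zero_outside[OF assms(1)] box_subset_cbox
    by (intro closure_minimal) fastforce+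
  moreover have "compact (closure {x. complex_of_real (bump k a b x) \<noteq> 0})"
    using supp by (meson bounded_cbox bounded_subset closed_closure compact_eq_bounded_closed)
  ultimately show ?thesis
    using assms(2) by (auto simp: test_functions_def flat_algebra_smooth)
qed

section \<open>The fundamental lemma of the calculus of variations\<close>

lemma sigma_finite_lebesgue: "sigma_finite_measure (lebesgue :: 'a::euclidean_space measure)"
proof -
  obtain A :: "'a set set" where A: "countable A" "A \<subseteq> sets lborel" "\<Union>A = space lborel"
      "\<forall>a\<in>A. emeasure lborel a \<noteq> \<infinity>"
    using lborel.sigma_finite_countable by blast
  moreover have "emeasure lebesgue a = emeasure lborel a" if "a \<in> A" for a
    using A(2) that by (subst emeasure_completion) (auto simp: main_part_sets subset_eq)
  ultimately show ?thesis
    by (intro sigma_finite_measure.intro exI[of _ A]) (auto simp: sets_completionI_sets)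
qed

text \<open>
  The Borel sets over which \<open>g\<close> has integral zero are closed under complement and disjoint
  countable union and contain the boxes, which are stable under intersection; by Dynkin's theorem
  they are all the Borel sets. A Lebesgue set differs from a Borel set by a null set.
\<close>

lemma AE_zero_if_box_integrals_zero:
  fixes g :: "'a::euclidean_space \<Rightarrow> 'b::{banach, second_countable_topology}"
  assumes g: "integrable lebesgue g"
    and box: "\<And>a b. set_lebesgue_integral lebesgue (box a b) g = 0"
  shows "AE x in lebesgue. g x = 0"
proof (rule sigma_finite_measure.density_zero[OF sigma_finite_lebesgue g])
  have si: "set_integrable lebesgue A g" if "A \<in> sets lebesgue" for A
    using that g by (simp add: set_integrable_def integrable_mult_indicator)
  have whole: "set_lebesgue_integral lebesgue UNIV g = 0"
  proof -
    define e :: 'a where e: "e = (\<Sum>i\<in>Basis. i)"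
    define B where "B n = box (- (real n *\<^sub>R e)) (real n *\<^sub>R e)" for n :: nat
    have ei: "e \<bullet> i = 1" if "i \<in> Basis" for i
      using that unfolding e by (simp add: inner_sum_left inner_Basis if_distrib cong: if_cong)
    have "incseq B"
      unfolding B_def incseq_def
      by (auto simp: mem_box ei less_le_trans)
         (smt (verit, best) ei of_nat_le_iff)+
    moreover have "(\<Union>n. B n) = UNIV"
    proof -
      have "\<exists>n. x \<in> B n" for x
      proof -
        obtain n where "norm x < real n" using reals_Archimedean2 by blast
        then have "x \<in> B n"
          unfolding B_def mem_box
          using Basis_le_norm[of _ x] by (fastforce simp: ei abs_le_iff)
        then show ?thesis by blast
      qed
      then show ?thesis by auto
    qed
    ultimately have "(\<lambda>n. set_lebesgue_integral lebesgue (B n) g) \<longlonglongrightarrow> set_lebesgue_integral lebesgue UNIV g"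
      using set_integral_cont_up[of B lebesgue g] si[of UNIV] by (auto simp: B_def)
    then show ?thesis
      by (simp add: B_def box LIMSEQ_const_iff)
  qed
  have borel0: "set_lebesgue_integral lebesgue A g = 0" if "A \<in> sets borel" for A
  proof -
    have "Int_stable (range (\<lambda>(a, b). box a b :: 'a set))"
      by (auto simp: Int_stable_def box_Int_box)
    moreover have "range (\<lambda>(a, b). box a b :: 'a set) \<subseteq> Pow UNIV"
      by auto
    moreover have "A \<in> sigma_sets UNIV (range (\<lambda>(a, b). box a b))"
      using that unfolding borel_eq_box by simp
    ultimately show ?thesis
    proof (induction rule: sigma_sets_induct_disjoint)
      case (basic A)
      then show ?case by (auto simp: box)
    next
      case empty
      then show ?case by (simp add: set_lebesgue_integral_def)
    next
      case (compl A)
      then have [measurable]: "A \<in> sets borel"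
        by (simp add: borel_eq_box)
      have "set_lebesgue_integral lebesgue (A \<union> (UNIV - A)) g =
          set_lebesgue_integral lebesgue A g + set_lebesgue_integral lebesgue (UNIV - A) g"
        by (intro set_integral_Un si) auto
      then show ?case using whole compl.IH by simp
    next
      case (union F)
      then have [measurable]: "\<And>i. F i \<in> sets borel"
        by (auto simp: borel_eq_box)
      have "set_lebesgue_integral lebesgue (\<Union>i. F i) g = (\<Sum>i. set_lebesgue_integral lebesgue (F i) g)"
        using union.hyps
        by (intro lebesgue_integral_countable_add si) (auto simp: disjoint_family_on_def)
      then show ?case using union.IH by simp
    qed
  qed
  fix A :: "'a set" assume "A \<in> sets lebesgue"
  then obtain S N N' where A: "A = S \<union> N" and S: "S \<in> sets borel" and "N' \<in> null_sets lborel" "N \<subseteq> N'"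
    by (elim sets_completionE) auto
  then have "N \<in> null_sets lebesgue"
    using null_sets_completion_subset null_sets_completionI by blast
  then have "AE x in lebesgue. x \<notin> N" by (rule AE_not_in)
  then have "set_lebesgue_integral lebesgue A g = set_lebesgue_integral lebesgue S g"
    using si[OF \<open>A \<in> sets lebesgue\<close>] si[of S] S unfolding A
    by (intro set_integral_cong_set) (auto simp: set_borel_measurable_def set_integrable_def)
  then show "set_lebesgue_integral lebesgue A g = 0"
    using borel0[OF S] by simp
qed

text \<open>
  Dominated convergence along bumps that tend to the indicator of the box. The closed box lies in
  \<open>\<Omega>\<close>, so \<open>g\<close> is integrable on it and the bumps are test functions.
\<close>

lemma box_integral_zero_if_test_integrals_zero:
  fixes g :: "real ^ 'n \<Rightarrow> complex"
  assumes g: "loc_integrable \<Omega> g"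
    and test: "\<And>\<phi>. \<phi> \<in> test_functions \<Omega> \<Longrightarrow> set_lebesgue_integral lebesgue \<Omega> (\<lambda>x. g x * \<phi> x) = 0"
    and sub: "cbox a b \<subseteq> \<Omega>"
  shows "set_lebesgue_integral lebesgue (box a b) g = 0"
proof -
  have int: "integrable lebesgue (\<lambda>x. indicator (cbox a b) x *\<^sub>R g x)"
    using g sub by (simp add: loc_integrable_def set_integrable_def)
  then have int': "integrable lebesgue (\<lambda>x. indicator (box a b) x *\<^sub>R g x)"
    using set_integrable_subset[of lebesgue "cbox a b" g "box a b"] box_subset_cbox
    by (auto simp: set_integrable_def)
  define F where "F = (\<lambda>n x. indicator \<Omega> x *\<^sub>R (g x * complex_of_real (bump (real (Suc n)) a b x)))"
  have F_eq: "F n x = (indicator (box a b) x *\<^sub>R g x) * complex_of_real (bump (real (Suc n)) a b x)" for n x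
    using bump_zero_outside[of "real (Suc n)" x a b] sub box_subset_cbox[of a b]
    by (auto simp: F_def indicator_def)
  have cont: "continuous_on UNIV (\<lambda>x. complex_of_real (bump (real (Suc n)) a b x))" for n
  proof (rule differentiable_imp_continuous_on, unfold differentiable_on_def, rule ballI)
    fix x :: "real ^ 'n"
    have "smooth_fun (\<lambda>x. complex_of_real (bump (real (Suc n)) a b x))"
      using bump_test_function[of "real (Suc n)" a b UNIV] by (simp add: test_functions_def)
    then have "iter_partial [] (\<lambda>x. complex_of_real (bump (real (Suc n)) a b x)) differentiable (at x)"
      unfolding smooth_fun_def by blast
    then show "(\<lambda>x. complex_of_real (bump (real (Suc n)) a b x)) differentiable (at x within UNIV)"
      by simp
  qed
  have meas: "(\<lambda>x. complex_of_real (bump (real (Suc n)) a b x)) \<in> borel_measurable lebesgue" for n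
    using borel_measurable_continuous_onI[OF cont[of n]] by (simp add: measurable_completion)
  have "(\<lambda>n. integral\<^sup>L lebesgue (F n)) \<longlonglongrightarrow> integral\<^sup>L lebesgue (\<lambda>x. indicator (box a b) x *\<^sub>R g x)"
  proof (rule integral_dominated_convergence)
    show "integrable lebesgue (\<lambda>x. norm (indicator (box a b) x *\<^sub>R g x))"
      using int' by (rule integrable_norm)
    show "F n \<in> borel_measurable lebesgue" for n
      using meas[of n] int' unfolding F_eq by (intro borel_measurable_times) auto
    show "AE x in lebesgue. (\<lambda>n. F n x) \<longlonglongrightarrow> indicator (box a b) x *\<^sub>R g x"
    proof (rule AE_I2)
      fix x
      show "(\<lambda>n. F n x) \<longlonglongrightarrow> indicator (box a b) x *\<^sub>R g x"
      proof (cases "x \<in> box a b")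
        case True
        have "(\<lambda>n. (indicator (box a b) x *\<^sub>R g x) * complex_of_real (bump (real (Suc n)) a b x))
            \<longlonglongrightarrow> (indicator (box a b) x *\<^sub>R g x) * complex_of_real 1"
          using bump_tendsto_1[OF True] by (intro tendsto_intros)
        then show ?thesis by (simp add: F_eq)
      qed (simp add: F_eq)
    qed
    show "AE x in lebesgue. norm (F n x) \<le> norm (indicator (box a b) x *\<^sub>R g x)" for n
      unfolding F_eq norm_mult norm_of_real
      by (intro AE_I2 mult_right_le_one_le) (auto simp: abs_of_nonneg bump_bounds)
  qed (use int' in simp)
  moreover have "integral\<^sup>L lebesgue (F n) = 0" for n
    using test[OF bump_test_function[OF _ sub, of "real (Suc n)"]]
    by (simp add: F_def set_lebesgue_integral_def)
  ultimately show ?thesis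
    by (simp add: set_lebesgue_integral_def LIMSEQ_const_iff)
qed

text \<open>
  Cover \<open>\<Omega>\<close> by countably many closed boxes. On each of them \<open>g\<close> is integrable, and its integral over
  any smaller box is zero by the preceding lemma.
\<close>

lemma fundamental_lemma_calculus_of_variations:
  fixes g :: "real ^ 'n \<Rightarrow> complex"
  assumes "open \<Omega>" and g: "loc_integrable \<Omega> g"
    and test: "\<And>\<phi>. \<phi> \<in> test_functions \<Omega> \<Longrightarrow> set_lebesgue_integral lebesgue \<Omega> (\<lambda>x. g x * \<phi> x) = 0"
  shows "AE x in lebesgue. x \<in> \<Omega> \<longrightarrow> g x = 0"
proof -
  have cb: "AE x in lebesgue. x \<in> cbox c d \<longrightarrow> g x = 0" if sub: "cbox c d \<subseteq> \<Omega>" for c d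
  proof -
    \<comment> \<open>Cutting off with the open box keeps the intersections with other boxes of the form \<open>box a b\<close>.\<close>
    define h where "h = (\<lambda>x. indicator (box c d) x *\<^sub>R g x)"
    have "set_integrable lebesgue (cbox c d) g"
      using g sub by (simp add: loc_integrable_def)
    then have "integrable lebesgue h"
      using set_integrable_subset[of lebesgue "cbox c d" g "box c d"] box_subset_cbox
      by (auto simp: set_integrable_def h_def)
    moreover have "set_lebesgue_integral lebesgue (box a b) h = 0" for a b
    proof -
      obtain a' b' where ab: "box a b \<inter> box c d = box a' b'"
        using box_Int_box by blast
      have "set_lebesgue_integral lebesgue (box a b) h = set_lebesgue_integral lebesgue (box a' b') g"
        unfolding set_lebesgue_integral_def h_def ab[symmetric]
        by (intro Bochner_Integration.integral_cong) (auto simp: indicator_def)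
      also have "\<dots> = 0"
      proof (cases "box a' b' = {}")
        case False
        then have "cbox a' b' \<subseteq> cbox c d"
          using ab closure_mono[of "box a' b'" "box c d"] closure_box
          by (metis Int_lower2 closure_minimal closed_cbox box_subset_cbox order_trans)
        then show ?thesis
          using box_integral_zero_if_test_integrals_zero[OF g test] sub by blast
      qed (simp add: set_lebesgue_integral_def)
      finally show ?thesis .
    qed
    ultimately have "AE x in lebesgue. h x = 0"
      by (rule AE_zero_if_box_integrals_zero)
    moreover have "AE x in lebesgue. x \<notin> cbox c d - box c d"
      using negligible_frontier_interval[of c d] unfolding negligible_iff_null_sets by (rule AE_not_in)
    ultimately show ?thesis
      by eventually_elim (auto simp: h_def)
  qed
  obtain \<D> where D: "countable \<D>" "\<D> \<subseteq> Pow \<Omega>" "\<And>X. X \<in> \<D> \<Longrightarrow> \<exists>a b. X = cbox a b" "\<Union>\<D> = \<Omega>"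
    using open_countable_Union_open_cbox[OF \<open>open \<Omega>\<close>] by metis
  have "AE x in lebesgue. \<forall>X\<in>\<D>. x \<in> X \<longrightarrow> g x = 0"
    using D cb by (subst AE_ball_countable) (auto, blast)
  then show ?thesis
    by eventually_elim (use D(4) in blast)
qed

section \<open>Uniqueness and linearity of weak derivatives\<close>

lemma continuous_on_iter_partial:
  assumes "smooth_fun \<phi>"
  shows "continuous_on UNIV (iter_partial \<alpha> \<phi>)"
  using assms unfolding smooth_fun_def
  by (intro differentiable_imp_continuous_on) (simp add: differentiable_on_def)

lemma iter_partial_zero_outside_support:
  assumes "x \<notin> closure {x. \<phi> x \<noteq> 0}"
  shows "iter_partial \<alpha> \<phi> x = 0"
  using assms
proof (induction \<alpha> arbitrary: x)
  case Nil
  then have "x \<notin> {x. \<phi> x \<noteq> 0}"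
    by (metis closure_subset subsetD)
  then show ?case by simp
next
  case (Cons i \<alpha>)
  have "((\<lambda>_. 0) has_derivative (\<lambda>_. 0)) (at x)"
    by simp
  then have "(iter_partial \<alpha> \<phi> has_derivative (\<lambda>_. 0)) (at x)"
  proof (rule has_derivative_transform_within_open)
    show "open (- closure {x. \<phi> x \<noteq> 0})" "x \<in> - closure {x. \<phi> x \<noteq> 0}"
      using Cons.prems by (simp_all add: open_Compl)
    show "0 = iter_partial \<alpha> \<phi> y" if "y \<in> - closure {x. \<phi> x \<noteq> 0}" for y
      using Cons.IH[of y] that by simp
  qed
  then have "(\<lambda>_. 0) = frechet_derivative (iter_partial \<alpha> \<phi>) (at x)"
    by (rule frechet_derivative_at)
  from fun_cong[OF this, of "axis i 1"] show ?case
    by simp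
qed

text \<open>
  A derivative of a test function is bounded and supported in a compact subset of \<open>\<Omega>\<close>, so its
  product with a locally integrable function is integrable on all of \<open>\<Omega>\<close>. This is what makes
  the integrals in the definition of weak derivatives additive.
\<close>

lemma loc_integrable_times_test:
  assumes g: "loc_integrable \<Omega> g" and \<phi>: "\<phi> \<in> test_functions \<Omega>"
  shows "set_integrable lebesgue \<Omega> (\<lambda>x. g x * iter_partial \<alpha> \<phi> x)"
proof -
  define K where "K = closure {x. \<phi> x \<noteq> 0}"
  have K: "compact K" "K \<subseteq> \<Omega>" and smooth: "smooth_fun \<phi>"
    using \<phi> by (auto simp: test_functions_def K_def)
  have int: "integrable lebesgue (\<lambda>x. indicator K x *\<^sub>R g x)"
    using g K by (simp add: loc_integrable_def set_integrable_def)
  have cont: "continuous_on UNIV (iter_partial \<alpha> \<phi>)"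
    using smooth by (rule continuous_on_iter_partial)
  then have "bounded (iter_partial \<alpha> \<phi> ` K)"
    using K(1) by (meson compact_continuous_image compact_imp_bounded continuous_on_subset subset_UNIV)
  then obtain B where B: "\<And>x. x \<in> K \<Longrightarrow> cmod (iter_partial \<alpha> \<phi> x) \<le> B"
    by (auto simp: bounded_iff)
  have eq: "indicator \<Omega> x *\<^sub>R (g x * iter_partial \<alpha> \<phi> x) = (indicator K x *\<^sub>R g x) * iter_partial \<alpha> \<phi> x" for x
    using iter_partial_zero_outside_support[of x \<phi> \<alpha>] K(2) by (auto simp: K_def indicator_def)
  have meas: "iter_partial \<alpha> \<phi> \<in> borel_measurable lebesgue"
    using borel_measurable_continuous_onI[OF cont] by (simp add: measurable_completion)
  have "integrable lebesgue (\<lambda>x. (indicator K x *\<^sub>R g x) * iter_partial \<alpha> \<phi> x)"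
  proof (rule Bochner_Integration.integrable_bound)
    show "integrable lebesgue (\<lambda>x. B * norm (indicator K x *\<^sub>R g x))"
      using integrable_norm[OF int] by (rule integrable_mult_right)
    show "(\<lambda>x. (indicator K x *\<^sub>R g x) * iter_partial \<alpha> \<phi> x) \<in> borel_measurable lebesgue"
      using borel_measurable_integrable[OF int] meas by (rule borel_measurable_times)
    show "AE x in lebesgue. norm ((indicator K x *\<^sub>R g x) * iter_partial \<alpha> \<phi> x)
        \<le> norm (B * norm (indicator K x *\<^sub>R g x))"
    proof (rule AE_I2)
      fix x
      show "norm ((indicator K x *\<^sub>R g x) * iter_partial \<alpha> \<phi> x) \<le> norm (B * norm (indicator K x *\<^sub>R g x))"
      proof (cases "x \<in> K")
        case True
        then have "cmod (g x) * cmod (iter_partial \<alpha> \<phi> x) \<le> \<bar>B\<bar> * cmod (g x)"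
          using B[OF True] by (subst mult.commute) (intro mult_right_mono, auto)
        then show ?thesis
          using True by (simp add: norm_mult abs_mult)
      qed simp
    qed
  qed
  then show ?thesis
    by (simp add: set_integrable_def eq)
qed

lemma loc_integrable_lincomb:
  assumes "loc_integrable \<Omega> f" "loc_integrable \<Omega> g"
  shows "loc_integrable \<Omega> (\<lambda>x. c * f x + d * g x)"
  using assms by (simp add: loc_integrable_def)

lemma integral_lincomb_times_test:
  assumes "loc_integrable \<Omega> f" "loc_integrable \<Omega> g" "\<phi> \<in> test_functions \<Omega>"
  shows "set_lebesgue_integral lebesgue \<Omega> (\<lambda>x. (c * f x + d * g x) * iter_partial \<alpha> \<phi> x) =
    c * set_lebesgue_integral lebesgue \<Omega> (\<lambda>x. f x * iter_partial \<alpha> \<phi> x) +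
    d * set_lebesgue_integral lebesgue \<Omega> (\<lambda>x. g x * iter_partial \<alpha> \<phi> x)"
proof -
  define \<psi> where "\<psi> = iter_partial \<alpha> \<phi>"
  have "set_integrable lebesgue \<Omega> (\<lambda>x. c * (f x * \<psi> x))"
    using loc_integrable_times_test[OF assms(1,3), of \<alpha>] by (simp add: \<psi>_def)
  moreover have "set_integrable lebesgue \<Omega> (\<lambda>x. d * (g x * \<psi> x))"
    using loc_integrable_times_test[OF assms(2,3), of \<alpha>] by (simp add: \<psi>_def)
  ultimately have "set_lebesgue_integral lebesgue \<Omega> (\<lambda>x. c * (f x * \<psi> x) + d * (g x * \<psi> x)) =
    c * set_lebesgue_integral lebesgue \<Omega> (\<lambda>x. f x * \<psi> x) +
    d * set_lebesgue_integral lebesgue \<Omega> (\<lambda>x. g x * \<psi> x)"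
    by (simp add: set_integral_add(2))
  then show ?thesis
    by (simp add: \<psi>_def ring_distribs mult.assoc)
qed

lemma is_weak_deriv_lincomb:
  assumes u: "is_weak_deriv \<Omega> \<alpha> u f" and v: "is_weak_deriv \<Omega> \<alpha> v g"
  shows "is_weak_deriv \<Omega> \<alpha> (\<lambda>x. c * u x + d * v x) (\<lambda>x. c * f x + d * g x)"
  unfolding is_weak_deriv_def
proof (intro conjI ballI)
  have li: "loc_integrable \<Omega> u" "loc_integrable \<Omega> v" "loc_integrable \<Omega> f" "loc_integrable \<Omega> g"
    using u v by (auto simp: is_weak_deriv_def)
  show "loc_integrable \<Omega> (\<lambda>x. c * u x + d * v x)" "loc_integrable \<Omega> (\<lambda>x. c * f x + d * g x)"
    using li by (simp_all add: loc_integrable_lincomb)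
  fix \<phi> assume \<phi>: "\<phi> \<in> test_functions \<Omega>"
  have "set_lebesgue_integral lebesgue \<Omega> (\<lambda>x. u x * iter_partial \<alpha> \<phi> x) =
        (-1) ^ length \<alpha> * set_lebesgue_integral lebesgue \<Omega> (\<lambda>x. f x * \<phi> x)"
      "set_lebesgue_integral lebesgue \<Omega> (\<lambda>x. v x * iter_partial \<alpha> \<phi> x) =
        (-1) ^ length \<alpha> * set_lebesgue_integral lebesgue \<Omega> (\<lambda>x. g x * \<phi> x)"
    using u v \<phi> by (simp_all add: is_weak_deriv_def)
  then show "set_lebesgue_integral lebesgue \<Omega> (\<lambda>x. (c * u x + d * v x) * iter_partial \<alpha> \<phi> x) =
      (-1) ^ length \<alpha> * set_lebesgue_integral lebesgue \<Omega> (\<lambda>x. (c * f x + d * g x) * \<phi> x)"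
    using integral_lincomb_times_test[OF li(3,4) \<phi>, of c d "[]"]
      integral_lincomb_times_test[OF li(1,2) \<phi>, of c d \<alpha>]
    by (simp add: ring_distribs mult_ac)
qed

lemma is_weak_deriv_unique_AE:
  assumes "open \<Omega>" and f: "is_weak_deriv \<Omega> \<alpha> u f" and g: "is_weak_deriv \<Omega> \<alpha> u g"
  shows "AE x in lebesgue. x \<in> \<Omega> \<longrightarrow> f x = g x"
proof -
  have li: "loc_integrable \<Omega> f" "loc_integrable \<Omega> g"
    using f g unfolding is_weak_deriv_def by blast+
  have "AE x in lebesgue. x \<in> \<Omega> \<longrightarrow> 1 * f x + (-1) * g x = 0"
  proof (rule fundamental_lemma_calculus_of_variations[OF \<open>open \<Omega>\<close>])
    show "loc_integrable \<Omega> (\<lambda>x. 1 * f x + (-1) * g x)"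
      using li by (rule loc_integrable_lincomb)
    fix \<phi> assume \<phi>: "\<phi> \<in> test_functions \<Omega>"
    have eq: "set_lebesgue_integral lebesgue \<Omega> (\<lambda>x. u x * iter_partial \<alpha> \<phi> x) =
        (-1) ^ length \<alpha> * set_lebesgue_integral lebesgue \<Omega> (\<lambda>x. k x * \<phi> x)"
      if "is_weak_deriv \<Omega> \<alpha> u k" for k
      using that \<phi> by (simp add: is_weak_deriv_def)
    have "(-1) ^ length \<alpha> * set_lebesgue_integral lebesgue \<Omega> (\<lambda>x. f x * \<phi> x) =
        (-1) ^ length \<alpha> * set_lebesgue_integral lebesgue \<Omega> (\<lambda>x. g x * \<phi> x)"
      by (rule trans[OF eq[OF f, symmetric] eq[OF g]])
    then have "set_lebesgue_integral lebesgue \<Omega> (\<lambda>x. f x * \<phi> x) =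
        set_lebesgue_integral lebesgue \<Omega> (\<lambda>x. g x * \<phi> x)"
      by simp
    then show "set_lebesgue_integral lebesgue \<Omega> (\<lambda>x. (1 * f x + (-1) * g x) * \<phi> x) = 0"
      using integral_lincomb_times_test[OF li \<phi>, of 1 "-1" "[]"] by simp
  qed
  then show ?thesis by simp
qed

lemma weak_deriv_eq_AE:
  assumes "open \<Omega>" "is_weak_deriv \<Omega> \<alpha> u g"
  shows "AE x in lebesgue. x \<in> \<Omega> \<longrightarrow> weak_deriv \<Omega> \<alpha> u x = g x"
  using is_weak_deriv_unique_AE[OF assms(1) _ assms(2)] someI[of "is_weak_deriv \<Omega> \<alpha> u", OF assms(2)]
  by (simp add: weak_deriv_def)

section \<open>Square integrable functions\<close>

lemma L2_iff:
  assumes "\<Omega> \<in> sets lebesgue"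
  shows "f \<in> L2 \<Omega> \<longleftrightarrow> f \<in> borel_measurable (lebesgue_on \<Omega>) \<and>
    integrable (lebesgue_on \<Omega>) (\<lambda>x. (cmod (f x))\<^sup>2)"
  using assms by (simp add: L2_def set_integrable_eq)

lemma L2_add:
  assumes "\<Omega> \<in> sets lebesgue" and f: "f \<in> L2 \<Omega>" and g: "g \<in> L2 \<Omega>"
  shows "(\<lambda>x. f x + g x) \<in> L2 \<Omega>"
proof -
  note iff = L2_iff[OF assms(1)]
  have meas[measurable]: "f \<in> borel_measurable (lebesgue_on \<Omega>)" "g \<in> borel_measurable (lebesgue_on \<Omega>)"
    using f g by (auto simp: iff)
  have "integrable (lebesgue_on \<Omega>) (\<lambda>x. (cmod (f x + g x))\<^sup>2)"
  proof (rule Bochner_Integration.integrable_bound)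
    show "integrable (lebesgue_on \<Omega>) (\<lambda>x. 2 * (cmod (f x))\<^sup>2 + 2 * (cmod (g x))\<^sup>2)"
      using f g by (auto simp: iff)
    have "(cmod (f x + g x))\<^sup>2 \<le> 2 * (cmod (f x))\<^sup>2 + 2 * (cmod (g x))\<^sup>2" for x
    proof -
      have "(cmod (f x + g x))\<^sup>2 \<le> (cmod (f x) + cmod (g x))\<^sup>2"
        by (intro power_mono norm_triangle_ineq) simp
      also have "\<dots> \<le> 2 * (cmod (f x))\<^sup>2 + 2 * (cmod (g x))\<^sup>2"
        using sum_squares_bound[of "cmod (f x)" "cmod (g x)"] by (simp add: power2_sum)
      finally show ?thesis .
    qed
    then show "AE x in lebesgue_on \<Omega>. norm ((cmod (f x + g x))\<^sup>2)
        \<le> norm (2 * (cmod (f x))\<^sup>2 + 2 * (cmod (g x))\<^sup>2)"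
      by (intro AE_I2) simp
  qed measurable
  then show ?thesis by (simp add: iff)
qed

lemma L2_bounded_mult:
  assumes "\<Omega> \<in> sets lebesgue" and f: "f \<in> L2 \<Omega>"
    and b: "b \<in> borel_measurable (lebesgue_on \<Omega>)" and B: "\<And>x. x \<in> \<Omega> \<Longrightarrow> cmod (b x) \<le> B"
  shows "(\<lambda>x. b x * f x) \<in> L2 \<Omega>"
proof -
  note iff = L2_iff[OF assms(1)]
  have meas[measurable]: "f \<in> borel_measurable (lebesgue_on \<Omega>)" "b \<in> borel_measurable (lebesgue_on \<Omega>)"
    using f b by (auto simp: iff)
  have "integrable (lebesgue_on \<Omega>) (\<lambda>x. (cmod (b x * f x))\<^sup>2)"
  proof (rule Bochner_Integration.integrable_bound)
    show "integrable (lebesgue_on \<Omega>) (\<lambda>x. B\<^sup>2 * (cmod (f x))\<^sup>2)"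
      using f by (auto simp: iff)
    have "(cmod (b x * f x))\<^sup>2 \<le> B\<^sup>2 * (cmod (f x))\<^sup>2" if "x \<in> \<Omega>" for x
      using B[OF that] by (auto simp: norm_mult power_mult_distrib intro!: mult_right_mono power_mono)
    then show "AE x in lebesgue_on \<Omega>. norm ((cmod (b x * f x))\<^sup>2) \<le> norm (B\<^sup>2 * (cmod (f x))\<^sup>2)"
      by (intro AE_I2) (simp add: space_restrict_space)
  qed measurable
  then show ?thesis by (simp add: iff)
qed

lemma L2_cmult:
  assumes "\<Omega> \<in> sets lebesgue" "f \<in> L2 \<Omega>"
  shows "(\<lambda>x. c * f x) \<in> L2 \<Omega>"
  using L2_bounded_mult[OF assms, of "\<lambda>_. c" "cmod c"] by simp

text \<open>
  Measurability also transfers, since the Lebesgue measure is complete. This carries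
  square integrability over to the representative picked by \<open>weak_deriv\<close>.
\<close>

lemma L2_cong_AE:
  assumes "\<Omega> \<in> sets lebesgue" "f \<in> L2 \<Omega>" and ae: "AE x in lebesgue. x \<in> \<Omega> \<longrightarrow> f x = g x"
  shows "g \<in> L2 \<Omega>"
proof -
  note iff = L2_iff[OF assms(1)]
  have f: "f \<in> borel_measurable (lebesgue_on \<Omega>)" "integrable (lebesgue_on \<Omega>) (\<lambda>x. (cmod (f x))\<^sup>2)"
    using assms(2) by (auto simp: iff)
  have ae': "AE x in lebesgue_on \<Omega>. f x = g x"
    using ae assms(1) by (simp add: AE_restrict_space_iff)
  have "(\<lambda>x. indicator \<Omega> x *\<^sub>R f x) \<in> borel_measurable lebesgue"
    using f(1) assms(1) by (simp add: borel_measurable_restrict_space_iff)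
  then have "(\<lambda>x. indicator \<Omega> x *\<^sub>R g x) \<in> borel_measurable lebesgue"
    by (rule borel_measurable_AE) (use ae in \<open>auto elim!: eventually_mono\<close>)
  then have g: "g \<in> borel_measurable (lebesgue_on \<Omega>)"
    using assms(1) by (simp add: borel_measurable_restrict_space_iff)
  have "integrable (lebesgue_on \<Omega>) (\<lambda>x. (cmod (g x))\<^sup>2)"
    by (rule integrable_cong_AE_imp[OF f(2)]) (use g ae' in auto)
  then show ?thesis
    using g by (simp add: iff)
qed

lemma L2_integrable_mult_cnj:
  assumes "\<Omega> \<in> sets lebesgue" and f: "f \<in> L2 \<Omega>" and g: "g \<in> L2 \<Omega>"
  shows "set_integrable lebesgue \<Omega> (\<lambda>x. f x * cnj (g x))"
proof -
  note iff = L2_iff[OF assms(1)]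
  have meas[measurable]: "f \<in> borel_measurable (lebesgue_on \<Omega>)" "g \<in> borel_measurable (lebesgue_on \<Omega>)"
    using f g by (auto simp: iff)
  have cnj[measurable]: "cnj \<in> borel_measurable borel"
    by (intro borel_measurable_continuous_onI continuous_intros)
  have "integrable (lebesgue_on \<Omega>) (\<lambda>x. f x * cnj (g x))"
  proof (rule Bochner_Integration.integrable_bound)
    show "integrable (lebesgue_on \<Omega>) (\<lambda>x. (cmod (f x))\<^sup>2 + (cmod (g x))\<^sup>2)"
      using f g by (auto simp: iff)
    have "cmod (f x) * cmod (g x) \<le> (cmod (f x))\<^sup>2 + (cmod (g x))\<^sup>2" for x
    proof -
      have "0 \<le> cmod (f x) * cmod (g x)" by simp
      then show ?thesis
        using sum_squares_bound[of "cmod (f x)" "cmod (g x)"] unfolding mult.assoc by linarith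
    qed
    then show "AE x in lebesgue_on \<Omega>. norm (f x * cnj (g x)) \<le> norm ((cmod (f x))\<^sup>2 + (cmod (g x))\<^sup>2)"
      by (intro AE_I2) (simp add: norm_mult)
  qed measurable
  then show ?thesis
    using assms(1) by (simp add: set_integrable_eq)
qed

section \<open>Weak derivatives of Sobolev functions\<close>

lemma weak_deriv_in_L2:
  assumes "open \<Omega>" "u \<in> sobolev k \<Omega>" "length \<alpha> \<le> k"
  shows "weak_deriv \<Omega> \<alpha> u \<in> L2 \<Omega>"
proof -
  obtain g where g: "g \<in> L2 \<Omega>" "is_weak_deriv \<Omega> \<alpha> u g"
    using assms(2,3) by (auto simp: sobolev_def)
  have "AE x in lebesgue. x \<in> \<Omega> \<longrightarrow> g x = weak_deriv \<Omega> \<alpha> u x"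
    using weak_deriv_eq_AE[OF assms(1) g(2)] by eventually_elim simp
  then show ?thesis
    using L2_cong_AE[OF _ g(1)] assms(1) by simp
qed

lemma weak_deriv_lincomb_AE:
  assumes "open \<Omega>" "u \<in> sobolev k \<Omega>" "v \<in> sobolev k \<Omega>" "length \<alpha> \<le> k"
  shows "AE x in lebesgue. x \<in> \<Omega> \<longrightarrow> weak_deriv \<Omega> \<alpha> (\<lambda>x. c * u x + d * v x) x =
    c * weak_deriv \<Omega> \<alpha> u x + d * weak_deriv \<Omega> \<alpha> v x"
proof -
  have ex: "\<exists>g. is_weak_deriv \<Omega> \<alpha> u g" if "u \<in> sobolev k \<Omega>" for u
    using that assms(4) unfolding sobolev_def mem_Collect_eq by metis
  obtain f g where f: "is_weak_deriv \<Omega> \<alpha> u f" and g: "is_weak_deriv \<Omega> \<alpha> v g"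
    using ex[OF assms(2)] ex[OF assms(3)] by metis
  show ?thesis
    using weak_deriv_eq_AE[OF assms(1) f] weak_deriv_eq_AE[OF assms(1) g]
      weak_deriv_eq_AE[OF assms(1) is_weak_deriv_lincomb[OF f g, of c d]]
    by eventually_elim simp
qed

section \<open>The energy balance of one time step\<close>

text \<open>
  The common pattern of all terms of the balance: an identity between the integrands, possibly
  only almost everywhere, becomes an identity between the tested scheme and the energy.
\<close>

lemma Re_diff_set_integral_eq:
  fixes \<phi> \<psi> :: "'a \<Rightarrow> complex" and p q :: "'a \<Rightarrow> real"
  assumes "set_integrable M \<Omega> \<phi>" "set_integrable M \<Omega> \<psi>" "set_integrable M \<Omega> p" "set_integrable M \<Omega> q"
    and ae: "AE x in M. x \<in> \<Omega> \<longrightarrow> Re (\<phi> x - \<psi> x) = p x - q x"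
  shows "Re (set_lebesgue_integral M \<Omega> \<phi> - set_lebesgue_integral M \<Omega> \<psi>) =
    set_lebesgue_integral M \<Omega> p - set_lebesgue_integral M \<Omega> q"
proof -
  let ?\<phi> = "\<lambda>x. indicator \<Omega> x *\<^sub>R \<phi> x" and ?\<psi> = "\<lambda>x. indicator \<Omega> x *\<^sub>R \<psi> x"
  let ?p = "\<lambda>x. indicator \<Omega> x *\<^sub>R p x" and ?q = "\<lambda>x. indicator \<Omega> x *\<^sub>R q x"
  have int: "integrable M ?\<phi>" "integrable M ?\<psi>" "integrable M ?p" "integrable M ?q"
    using assms(1-4) by (simp_all add: set_integrable_def)
  have "Re (integral\<^sup>L M ?\<phi> - integral\<^sup>L M ?\<psi>) = (\<integral>x. Re (?\<phi> x - ?\<psi> x) \<partial>M)"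
    using int by (simp only: integral_Re Bochner_Integration.integral_diff Bochner_Integration.integrable_diff)
  also have "\<dots> = (\<integral>x. ?p x - ?q x \<partial>M)"
  proof (rule integral_cong_AE)
    show "(\<lambda>x. Re (?\<phi> x - ?\<psi> x)) \<in> borel_measurable M"
      by (rule borel_measurable_integrable, rule integrable_Re, rule Bochner_Integration.integrable_diff)
        (rule int)+
    show "(\<lambda>x. ?p x - ?q x) \<in> borel_measurable M"
      by (rule borel_measurable_integrable, rule Bochner_Integration.integrable_diff) (rule int)+
    show "AE x in M. Re (?\<phi> x - ?\<psi> x) = ?p x - ?q x"
      using ae by eventually_elim (auto simp: indicator_def)
  qed
  also have "\<dots> = integral\<^sup>L M ?p - integral\<^sup>L M ?q"
    using int by simp
  finally show ?thesis
    by (simp add: set_lebesgue_integral_def)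
qed

lemma power2_l2_norm:
  "(l2_norm \<Omega> f)\<^sup>2 = set_lebesgue_integral lebesgue \<Omega> (\<lambda>x. (norm (f x))\<^sup>2)"
proof -
  have "0 \<le> set_lebesgue_integral lebesgue \<Omega> (\<lambda>x. (norm (f x))\<^sup>2)"
    unfolding set_lebesgue_integral_def by (intro integral_nonneg_AE AE_I2) simp
  then show ?thesis by (simp add: l2_norm_def)
qed

lemma norm_vec_power2:
  fixes v :: "complex ^ 'n"
  shows "(norm v)\<^sup>2 = (\<Sum>i\<in>UNIV. (cmod (v $ i))\<^sup>2)"
  by (simp add: norm_vec_def L2_set_def sum_nonneg)

lemma Re_second_diff_test:
  "Re ((a - 2 * b + c) / of_real (\<tau>\<^sup>2) * cnj a - (a - 2 * b + c) / of_real (\<tau>\<^sup>2) * cnj c) =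
    (cmod ((a - b) / of_real \<tau>))\<^sup>2 - (cmod ((b - c) / of_real \<tau>))\<^sup>2"
proof -
  have "Re ((a - 2 * b + c) * cnj (a - c)) = (cmod (a - b))\<^sup>2 - (cmod (b - c))\<^sup>2"
    unfolding cmod_power2 by (simp add: power2_eq_square algebra_simps)
  moreover have "(a - 2 * b + c) / of_real (\<tau>\<^sup>2) * cnj a - (a - 2 * b + c) / of_real (\<tau>\<^sup>2) * cnj c =
      (a - 2 * b + c) * cnj (a - c) / of_real (\<tau>\<^sup>2)"
    by (simp add: ring_distribs diff_divide_distrib add_divide_distrib)
  moreover have "(cmod (z / of_real \<tau>))\<^sup>2 = (cmod z)\<^sup>2 / \<tau>\<^sup>2" for z
    by (simp add: norm_divide power_divide)
  ultimately show ?thesis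
    by (simp only: Re_divide_of_real) (simp only: diff_divide_distrib[where ?'a = real])
qed

lemma Re_average_test:
  "Re (of_real s * ((c + a) / 2) * cnj a - of_real s * ((c + a) / 2) * cnj c) =
    s * (cmod a)\<^sup>2 / 2 - s * (cmod c)\<^sup>2 / 2"
  unfolding cmod_power2 by (simp add: power2_eq_square field_simps)

lemma Re_ii_central_diff_test:
  "Re (\<i> * ((a - c) / of_real (2 * \<tau>)) * cnj a - \<i> * ((a - c) / of_real (2 * \<tau>)) * cnj c) = 0"
proof -
  have "\<i> * ((a - c) / of_real (2 * \<tau>)) * cnj a - \<i> * ((a - c) / of_real (2 * \<tau>)) * cnj c =
      \<i> * ((a - c) * cnj (a - c)) / of_real (2 * \<tau>)"
    by (simp only: complex_cnj_diff ring_distribs times_divide_eq_right times_divide_eq_left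
        diff_divide_distrib mult.assoc)
  also have "\<dots> = \<i> * of_real ((cmod (a - c))\<^sup>2) / of_real (2 * \<tau>)"
    by (simp only: complex_norm_square)
  finally show ?thesis
    by (simp only: Re_divide_of_real) simp
qed

text \<open>
  The balance holds for any three consecutive bounded Sobolev functions that satisfy the scheme
  tested with the first and the last of them. Boundedness makes the cubic and the potential
  terms square integrable.
\<close>

lemma discrete_energy_step:
  fixes \<Omega> :: "(real ^ 'n) set" and w :: "real ^ 'n \<Rightarrow> real"
  assumes "open \<Omega>" "n \<ge> 1"
    and U: "\<And>m. m \<in> {n - 1, n, n + 1} \<Longrightarrow> U m \<in> sobolev 1 \<Omega>"
    and B: "\<And>m x. m \<in> {n - 1, n, n + 1} \<Longrightarrow> x \<in> \<Omega> \<Longrightarrow> cmod (U m x) \<le> B"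
    and w: "(\<lambda>x. complex_of_real (w x)) \<in> L2 \<Omega>"
    and scheme: "\<And>v. v \<in> {U (n - 1), U (n + 1)} \<Longrightarrow>
          l2_inner \<Omega> (second_diff \<tau> U n) v
        + l2_inner_vec \<Omega> (weak_grad \<Omega> (time_avg U n)) (weak_grad \<Omega> v)
        + \<i> * l2_inner \<Omega> (central_diff \<tau> U n) v
        + l2_inner \<Omega> (\<lambda>x. of_real ((cmod (U n x))\<^sup>2) * time_avg U n x) v
        + l2_inner \<Omega> (\<lambda>x. of_real (w x) * time_avg U n x) v = 0"
  shows "discrete_energy \<Omega> \<tau> w U n = discrete_energy \<Omega> \<tau> w U (n - 1)"
proof -
  define a b c where "a = U (n + 1)" and "b = U n" and "c = U (n - 1)"
  define t where "t = time_avg U n"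
  have \<Omega>: "\<Omega> \<in> sets lebesgue" using \<open>open \<Omega>\<close> by simp
  note lc = L2_add[OF \<Omega> L2_cmult[OF \<Omega>] L2_cmult[OF \<Omega>]]
  note int = L2_integrable_mult_cnj[OF \<Omega>]
  have t: "t = (\<lambda>x. (c x + a x) / 2)"
    by (simp add: t_def time_avg_def a_def c_def fun_eq_iff)
  have t_lin: "t = (\<lambda>x. 1 / 2 * c x + 1 / 2 * a x)"
    by (simp add: t fun_eq_iff add_divide_distrib)
  have sob: "a \<in> sobolev 1 \<Omega>" "b \<in> sobolev 1 \<Omega>" "c \<in> sobolev 1 \<Omega>"
    using U by (simp_all add: a_def b_def c_def)
  then have L2: "a \<in> L2 \<Omega>" "b \<in> L2 \<Omega>" "c \<in> L2 \<Omega>"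
    by (simp_all add: sobolev_def)
  have bd: "cmod (a x) \<le> B" "cmod (b x) \<le> B" "cmod (c x) \<le> B" if "x \<in> \<Omega>" for x
    using B[OF _ that] by (simp_all add: a_def b_def c_def)
  have L2_t: "t \<in> L2 \<Omega>"
    unfolding t_lin by (rule lc[OF L2(3) L2(1)])
  have meas: "f \<in> borel_measurable (lebesgue_on \<Omega>)" if "f \<in> L2 \<Omega>" for f
    using that by (simp add: L2_def)
  have bd_t: "cmod (t x) \<le> B" if "x \<in> \<Omega>" for x
    using norm_triangle_ineq[of "c x" "a x"] bd[OF that] by (simp add: t norm_divide)
  have mult: "(\<lambda>x. f x * g x) \<in> L2 \<Omega>"
    if "f \<in> L2 \<Omega>" "g \<in> L2 \<Omega>" "\<And>x. x \<in> \<Omega> \<Longrightarrow> cmod (g x) \<le> B" for f g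
    using L2_bounded_mult[OF \<Omega> that(1) meas[OF that(2)] that(3)] by (simp add: mult.commute)
  have L2_wf: "(\<lambda>x. of_real (w x) * f x) \<in> L2 \<Omega>"
    if "f \<in> L2 \<Omega>" "\<And>x. x \<in> \<Omega> \<Longrightarrow> cmod (f x) \<le> B" for f
    using mult[OF w that] .
  have norm2: "set_integrable lebesgue \<Omega> (\<lambda>x. (cmod (f x))\<^sup>2)" if "f \<in> L2 \<Omega>" for f
    using that by (simp add: L2_def)
  have w_norm2: "set_integrable lebesgue \<Omega> (\<lambda>x. w x * (cmod (f x))\<^sup>2)"
    if "f \<in> L2 \<Omega>" "\<And>x. x \<in> \<Omega> \<Longrightarrow> cmod (f x) \<le> B" for f
  proof -
    have "set_integrable lebesgue \<Omega> (\<lambda>x. complex_of_real (w x * (cmod (f x))\<^sup>2))"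
      using int[OF L2_wf[OF that] that(1)]
      by (simp add: mult.assoc complex_norm_square[symmetric] del: of_real_power)
    then show ?thesis
      unfolding set_integrable_def using integrable_Re by (fastforce simp: scaleR_conv_of_real)
  qed
  have w_inner: "l2_inner \<Omega> (\<lambda>x. of_real (w x) * f x) f =
      of_real (set_lebesgue_integral lebesgue \<Omega> (\<lambda>x. w x * (cmod (f x))\<^sup>2))" for f
    unfolding l2_inner_def set_integral_complex_of_real[symmetric] mult.assoc complex_norm_square[symmetric]
    by (simp only: of_real_mult)

  have kinetic: "Re (l2_inner \<Omega> (second_diff \<tau> U n) a - l2_inner \<Omega> (second_diff \<tau> U n) c) =
      (l2_norm \<Omega> (\<lambda>x. (a x - b x) / of_real \<tau>))\<^sup>2 - (l2_norm \<Omega> (\<lambda>x. (b x - c x) / of_real \<tau>))\<^sup>2"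
  proof -
    have sd: "second_diff \<tau> U n = (\<lambda>x. (a x - 2 * b x + c x) / of_real (\<tau>\<^sup>2))"
      by (simp add: second_diff_def a_def b_def c_def fun_eq_iff)
    \<comment> \<open>The trivial factors bring the second difference into the form covered by \<open>lc\<close>.\<close>
    have "(\<lambda>x. (1 / of_real (\<tau>\<^sup>2)) * (1 * (1 * a x + (-2) * b x) + 1 * c x) + 0 * c x) \<in> L2 \<Omega>"
      by (intro lc L2)
    then have L2_sd: "second_diff \<tau> U n \<in> L2 \<Omega>"
      by (simp add: sd)
    have "(\<lambda>x. (1 / of_real \<tau>) * f x + (- 1 / of_real \<tau>) * g x) \<in> L2 \<Omega>" if "f \<in> L2 \<Omega>" "g \<in> L2 \<Omega>" for f g
      using that by (rule lc)
    then have L2_dq: "(\<lambda>x. (f x - g x) / of_real \<tau>) \<in> L2 \<Omega>" if "f \<in> L2 \<Omega>" "g \<in> L2 \<Omega>" for f g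
      using that by (simp add: diff_divide_distrib)
    show ?thesis
      unfolding l2_inner_def power2_l2_norm
      by (intro Re_diff_set_integral_eq int norm2 L2_dq L2 L2_sd AE_I2 impI)
        (simp only: sd Re_second_diff_test)
  qed

  have dissipation: "Re (\<i> * l2_inner \<Omega> (central_diff \<tau> U n) a - \<i> * l2_inner \<Omega> (central_diff \<tau> U n) c) = 0"
  proof -
    have cd: "central_diff \<tau> U n = (\<lambda>x. (a x - c x) / of_real (2 * \<tau>))"
      by (simp add: central_diff_def a_def c_def fun_eq_iff)
    have "(\<lambda>x. (1 / of_real (2 * \<tau>)) * a x + (- 1 / of_real (2 * \<tau>)) * c x) \<in> L2 \<Omega>"
      using L2 by (intro lc)
    then have L2_cd: "(\<lambda>x. \<i> * central_diff \<tau> U n x) \<in> L2 \<Omega>"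
      unfolding cd by (intro L2_cmult[OF \<Omega>]) (simp add: diff_divide_distrib)
    have "Re (l2_inner \<Omega> (\<lambda>x. \<i> * central_diff \<tau> U n x) a - l2_inner \<Omega> (\<lambda>x. \<i> * central_diff \<tau> U n x) c) =
        set_lebesgue_integral lebesgue \<Omega> (\<lambda>x. 0 :: real) - set_lebesgue_integral lebesgue \<Omega> (\<lambda>x. 0 :: real)"
      unfolding l2_inner_def
    proof (intro Re_diff_set_integral_eq int L2 L2_cd AE_I2 impI)
      show "Re (\<i> * central_diff \<tau> U n x * cnj (a x) - \<i> * central_diff \<tau> U n x * cnj (c x)) = 0 - 0" for x
        unfolding cd Re_ii_central_diff_test by simp
    qed (simp_all add: set_integrable_def)
    moreover have "l2_inner \<Omega> (\<lambda>x. \<i> * central_diff \<tau> U n x) f = \<i> * l2_inner \<Omega> (central_diff \<tau> U n) f" for f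
      unfolding l2_inner_def mult.assoc by (rule set_integral_mult_right)
    ultimately show ?thesis
      by simp
  qed

  \<comment> \<open>The potential and the cubic term differ only in the real weight \<open>s\<close>, which is \<open>w\<close> or \<open>\<bar>b\<bar>\<^sup>2\<close>.\<close>
  have weighted: "Re (l2_inner \<Omega> (\<lambda>x. of_real (s x) * t x) a - l2_inner \<Omega> (\<lambda>x. of_real (s x) * t x) c) =
      set_lebesgue_integral lebesgue \<Omega> (\<lambda>x. s x * (cmod (a x))\<^sup>2) / 2
      - set_lebesgue_integral lebesgue \<Omega> (\<lambda>x. s x * (cmod (c x))\<^sup>2) / 2"
    if "(\<lambda>x. of_real (s x) * t x) \<in> L2 \<Omega>"
      "set_integrable lebesgue \<Omega> (\<lambda>x. s x * (cmod (a x))\<^sup>2)"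
      "set_integrable lebesgue \<Omega> (\<lambda>x. s x * (cmod (c x))\<^sup>2)" for s :: "real ^ 'n \<Rightarrow> real"
  proof -
    have "Re (l2_inner \<Omega> (\<lambda>x. of_real (s x) * t x) a - l2_inner \<Omega> (\<lambda>x. of_real (s x) * t x) c) =
        set_lebesgue_integral lebesgue \<Omega> (\<lambda>x. s x * (cmod (a x))\<^sup>2 / 2)
        - set_lebesgue_integral lebesgue \<Omega> (\<lambda>x. s x * (cmod (c x))\<^sup>2 / 2)"
      unfolding l2_inner_def
    proof (intro Re_diff_set_integral_eq int L2 that(1) AE_I2 impI)
      show "Re (of_real (s x) * t x * cnj (a x) - of_real (s x) * t x * cnj (c x)) =
          s x * (cmod (a x))\<^sup>2 / 2 - s x * (cmod (c x))\<^sup>2 / 2" for x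
        unfolding t by (rule Re_average_test)
    qed (use that(2,3) in simp_all)
    then show ?thesis by simp
  qed

  have potential: "Re (l2_inner \<Omega> (\<lambda>x. of_real (w x) * t x) a - l2_inner \<Omega> (\<lambda>x. of_real (w x) * t x) c) =
      set_lebesgue_integral lebesgue \<Omega> (\<lambda>x. w x * (cmod (a x))\<^sup>2) / 2
      - set_lebesgue_integral lebesgue \<Omega> (\<lambda>x. w x * (cmod (c x))\<^sup>2) / 2"
    using L2 bd L2_t bd_t by (intro weighted L2_wf w_norm2)

  have nonlinear: "Re (l2_inner \<Omega> (\<lambda>x. of_real ((cmod (b x))\<^sup>2) * t x) a
        - l2_inner \<Omega> (\<lambda>x. of_real ((cmod (b x))\<^sup>2) * t x) c) =
      (l2_norm \<Omega> (\<lambda>x. b x * a x))\<^sup>2 / 2 - (l2_norm \<Omega> (\<lambda>x. c x * b x))\<^sup>2 / 2"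
  proof -
    \<comment> \<open>The weight \<open>\<bar>b\<bar>\<^sup>2\<close> is split as \<open>cnj b * b\<close>, two bounded measurable factors.\<close>
    have "(\<lambda>x. cnj (b x) * (t x * b x)) \<in> L2 \<Omega>"
    proof (rule L2_bounded_mult[OF \<Omega>])
      show "(\<lambda>x. t x * b x) \<in> L2 \<Omega>"
        using mult[OF L2_t L2(2) bd(2)] .
      have "cnj \<in> borel_measurable borel"
        by (intro borel_measurable_continuous_onI continuous_intros)
      then show "(\<lambda>x. cnj (b x)) \<in> borel_measurable (lebesgue_on \<Omega>)"
        using meas[OF L2(2)] by (rule measurable_compose[rotated])
      show "cmod (cnj (b x)) \<le> B" if "x \<in> \<Omega>" for x
        using bd(2)[OF that] by simp
    qed
    moreover have "(\<lambda>x. cnj (b x) * (t x * b x)) = (\<lambda>x. of_real ((cmod (b x))\<^sup>2) * t x)"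
      unfolding complex_norm_square by (simp add: mult_ac)
    ultimately have L2_bt: "(\<lambda>x. of_real ((cmod (b x))\<^sup>2) * t x) \<in> L2 \<Omega>"
      by simp
    have "set_integrable lebesgue \<Omega> (\<lambda>x. (cmod (b x))\<^sup>2 * (cmod (f x))\<^sup>2)" if "f \<in> L2 \<Omega>" for f
      using norm2[OF mult[OF that L2(2) bd(2)]] by (simp add: norm_mult power_mult_distrib mult.commute)
    from weighted[OF L2_bt this[OF L2(1)] this[OF L2(3)]] show ?thesis
      by (simp add: power2_l2_norm norm_mult power_mult_distrib mult.commute)
  qed

  have gradient: "Re (l2_inner_vec \<Omega> (weak_grad \<Omega> t) (weak_grad \<Omega> a) - l2_inner_vec \<Omega> (weak_grad \<Omega> t) (weak_grad \<Omega> c)) =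
      (l2_norm \<Omega> (weak_grad \<Omega> a))\<^sup>2 / 2 - (l2_norm \<Omega> (weak_grad \<Omega> c))\<^sup>2 / 2"
  proof -
    have L2_wd: "weak_deriv \<Omega> [i] f \<in> L2 \<Omega>" if "f \<in> sobolev 1 \<Omega>" for f i
      by (rule weak_deriv_in_L2[OF \<open>open \<Omega>\<close> that]) simp
    have wd_t: "AE x in lebesgue. x \<in> \<Omega> \<longrightarrow>
        1 / 2 * weak_deriv \<Omega> [i] c x + 1 / 2 * weak_deriv \<Omega> [i] a x = weak_deriv \<Omega> [i] t x" for i
      using weak_deriv_lincomb_AE[OF \<open>open \<Omega>\<close> sob(3,1), of "[i]" "1 / 2" "1 / 2"]
      unfolding t_lin by (simp add: eq_commute)
    have L2_wd_t: "weak_deriv \<Omega> [i] t \<in> L2 \<Omega>" for i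
      by (rule L2_cong_AE[OF \<Omega> lc[OF L2_wd[OF sob(3)] L2_wd[OF sob(1)]] wd_t])
    have sum_int: "set_integrable lebesgue \<Omega> (\<lambda>x. \<Sum>i\<in>UNIV. f i x)"
      if "\<And>i. set_integrable lebesgue \<Omega> (f i)" for f :: "'n \<Rightarrow> real ^ 'n \<Rightarrow> 'b::{banach, second_countable_topology}"
      using that unfolding set_integrable_def scaleR_sum_right
      by (intro Bochner_Integration.integrable_sum)
    have inner_int: "set_integrable lebesgue \<Omega> (\<lambda>x. \<Sum>i\<in>UNIV. weak_grad \<Omega> t x $ i * cnj (weak_grad \<Omega> f x $ i))"
      if "f \<in> sobolev 1 \<Omega>" for f
      unfolding weak_grad_def vec_lambda_beta by (intro sum_int int L2_wd_t L2_wd that)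
    have norm_int: "set_integrable lebesgue \<Omega> (\<lambda>x. (norm (weak_grad \<Omega> f x))\<^sup>2 / 2)"
      if "f \<in> sobolev 1 \<Omega>" for f
      unfolding norm_vec_power2 weak_grad_def vec_lambda_beta
      by (intro set_integrable_divide sum_int norm2 L2_wd that)
    have "AE x in lebesgue. \<forall>i\<in>UNIV. x \<in> \<Omega> \<longrightarrow>
        1 / 2 * weak_deriv \<Omega> [i] c x + 1 / 2 * weak_deriv \<Omega> [i] a x = weak_deriv \<Omega> [i] t x"
      using wd_t by (intro AE_finite_allI) auto
    then have ae: "AE x in lebesgue. x \<in> \<Omega> \<longrightarrow>
        Re ((\<Sum>i\<in>UNIV. weak_grad \<Omega> t x $ i * cnj (weak_grad \<Omega> a x $ i))
          - (\<Sum>i\<in>UNIV. weak_grad \<Omega> t x $ i * cnj (weak_grad \<Omega> c x $ i))) =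
        (norm (weak_grad \<Omega> a x))\<^sup>2 / 2 - (norm (weak_grad \<Omega> c x))\<^sup>2 / 2"
    proof eventually_elim
      case (elim x)
      show ?case
      proof
        assume "x \<in> \<Omega>"
        have "Re (weak_grad \<Omega> t x $ i * cnj (weak_grad \<Omega> a x $ i)
            - weak_grad \<Omega> t x $ i * cnj (weak_grad \<Omega> c x $ i)) =
            (cmod (weak_grad \<Omega> a x $ i))\<^sup>2 / 2 - (cmod (weak_grad \<Omega> c x $ i))\<^sup>2 / 2" for i
        proof -
          have "weak_grad \<Omega> t x $ i = (weak_grad \<Omega> c x $ i + weak_grad \<Omega> a x $ i) / 2"
            using elim \<open>x \<in> \<Omega>\<close> by (simp add: weak_grad_def add_divide_distrib)
          then show ?thesis
            using Re_average_test[of 1 "weak_grad \<Omega> c x $ i" "weak_grad \<Omega> a x $ i"]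
            by (simp only: of_real_1 mult_1_left)
        qed
        then show "Re ((\<Sum>i\<in>UNIV. weak_grad \<Omega> t x $ i * cnj (weak_grad \<Omega> a x $ i))
            - (\<Sum>i\<in>UNIV. weak_grad \<Omega> t x $ i * cnj (weak_grad \<Omega> c x $ i))) =
          (norm (weak_grad \<Omega> a x))\<^sup>2 / 2 - (norm (weak_grad \<Omega> c x))\<^sup>2 / 2"
          by (simp only: sum_subtractf[symmetric] Re_sum norm_vec_power2 sum_divide_distrib)
      qed
    qed
    have "Re (l2_inner_vec \<Omega> (weak_grad \<Omega> t) (weak_grad \<Omega> a) - l2_inner_vec \<Omega> (weak_grad \<Omega> t) (weak_grad \<Omega> c)) =
        set_lebesgue_integral lebesgue \<Omega> (\<lambda>x. (norm (weak_grad \<Omega> a x))\<^sup>2 / 2)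
        - set_lebesgue_integral lebesgue \<Omega> (\<lambda>x. (norm (weak_grad \<Omega> c x))\<^sup>2 / 2)"
      unfolding l2_inner_vec_def
      by (rule Re_diff_set_integral_eq[OF inner_int inner_int norm_int norm_int ae]) (rule sob)+
    then show ?thesis
      by (simp add: power2_l2_norm)
  qed

  define S where "S v = l2_inner \<Omega> (second_diff \<tau> U n) v
        + l2_inner_vec \<Omega> (weak_grad \<Omega> t) (weak_grad \<Omega> v)
        + \<i> * l2_inner \<Omega> (central_diff \<tau> U n) v
        + l2_inner \<Omega> (\<lambda>x. of_real ((cmod (b x))\<^sup>2) * t x) v
        + l2_inner \<Omega> (\<lambda>x. of_real (w x) * t x) v" for v
  have "S a = 0" "S c = 0"
    using scheme by (simp_all add: S_def a_def b_def c_def t_def)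
  then have "Re (S a - S c) = 0" by simp
  then have balance:
    "(l2_norm \<Omega> (\<lambda>x. (a x - b x) / of_real \<tau>))\<^sup>2 + (l2_norm \<Omega> (weak_grad \<Omega> a))\<^sup>2 / 2
      + (l2_norm \<Omega> (\<lambda>x. b x * a x))\<^sup>2 / 2 + set_lebesgue_integral lebesgue \<Omega> (\<lambda>x. w x * (cmod (a x))\<^sup>2) / 2
    = (l2_norm \<Omega> (\<lambda>x. (b x - c x) / of_real \<tau>))\<^sup>2 + (l2_norm \<Omega> (weak_grad \<Omega> c))\<^sup>2 / 2
      + (l2_norm \<Omega> (\<lambda>x. c x * b x))\<^sup>2 / 2 + set_lebesgue_integral lebesgue \<Omega> (\<lambda>x. w x * (cmod (c x))\<^sup>2) / 2"
    using kinetic dissipation potential nonlinear gradient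
    unfolding S_def minus_complex.sel plus_complex.sel by linarith
  have energy: "discrete_energy \<Omega> \<tau> w U m = of_real (
      (l2_norm \<Omega> (\<lambda>x. (U (m + 1) x - U m x) / of_real \<tau>))\<^sup>2
      + ((l2_norm \<Omega> (weak_grad \<Omega> (U (m + 1))))\<^sup>2 + (l2_norm \<Omega> (weak_grad \<Omega> (U m)))\<^sup>2) / 2
      + (l2_norm \<Omega> (\<lambda>x. U m x * U (m + 1) x))\<^sup>2 / 2
      + (set_lebesgue_integral lebesgue \<Omega> (\<lambda>x. w x * (cmod (U m x))\<^sup>2)
        + set_lebesgue_integral lebesgue \<Omega> (\<lambda>x. w x * (cmod (U (m + 1) x))\<^sup>2)) / 2)" for m
    unfolding discrete_energy_def w_inner by simp
  have "n - 1 + 1 = n" using \<open>n \<ge> 1\<close> by simp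
  then show ?thesis
    unfolding energy of_real_eq_iff using balance
    unfolding a_def[symmetric] b_def[symmetric] c_def[symmetric] \<open>n - 1 + 1 = n\<close>
    by (simp add: field_simps)
qed

section \<open>Conservation of the energy by the finite element scheme\<close>

lemma bounded_convex_polyhedral_domain:
  assumes "convex_polyhedral_domain \<Omega>"
  shows "bounded \<Omega>"
  using assms by (auto simp: convex_polyhedral_domain_def
      intro: bounded_subset[OF polytope_imp_bounded interior_subset])

lemma open_convex_polyhedral_domain:
  assumes "convex_polyhedral_domain \<Omega>"
  shows "open \<Omega>"
  using assms by (auto simp: convex_polyhedral_domain_def)

lemma fe_space_bounded:
  assumes "bounded \<Omega>" "v \<in> fe_space \<Omega> r \<T>"
  obtains B where "\<And>x. x \<in> \<Omega> \<Longrightarrow> cmod (v x) \<le> B"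
proof -
  have "continuous_on (closure \<Omega>) v"
    using assms(2) by (simp add: fe_space_def)
  moreover have "compact (closure \<Omega>)"
    using assms(1) by simp
  ultimately have "bounded (v ` closure \<Omega>)"
    by (intro compact_imp_bounded compact_continuous_image)
  then show ?thesis
    using closure_subset that by (fastforce simp: bounded_iff)
qed

theorem theorem1:
  fixes \<Omega> :: "(real ^ 'n) set"
    and H :: "real set" and \<T> :: "real \<Rightarrow> (real ^ 'n) set set" and h :: real
    and r N :: nat and T \<tau> :: real
    and w :: "real ^ 'n \<Rightarrow> real"
    and u0 u1 :: "real ^ 'n \<Rightarrow> complex"
    and V :: "(real ^ 'n \<Rightarrow> complex) set"
    and U :: "nat \<Rightarrow> real ^ 'n \<Rightarrow> complex"
  assumes dim: "CARD('n) = 2 \<or> CARD('n) = 3"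
    and domain: "convex_polyhedral_domain \<Omega>"
    and mesh: "quasi_uniform_meshes \<Omega> H \<T>" "h \<in> H"
    and degree: "r \<ge> 1"
    and V_def: "V = fe_space \<Omega> r (\<T> h)"
    and time: "T > 0" "N \<ge> 1" "\<tau> = T / real N"
    and potential: "(\<lambda>x. complex_of_real (w x)) \<in> sobolev (r + 1) \<Omega>"
    and data0: "u0 \<in> H10 \<Omega>" "\<exists>g. is_weak_laplacian \<Omega> u0 g"
    and data1: "first_step_data \<Omega> \<tau> w u0 u1 \<in> H10 \<Omega>"
    and U_in: "\<And>n. n \<le> N \<Longrightarrow> U n \<in> V"
    and scheme: "\<And>n v. \<lbrakk>1 \<le> n; n \<le> N - 1; v \<in> V\<rbrakk> \<Longrightarrow>
          l2_inner \<Omega> (second_diff \<tau> U n) v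
        + l2_inner_vec \<Omega> (weak_grad \<Omega> (time_avg U n)) (weak_grad \<Omega> v)
        + \<i> * l2_inner \<Omega> (central_diff \<tau> U n) v
        + l2_inner \<Omega> (\<lambda>x. of_real ((cmod (U n x))\<^sup>2) * time_avg U n x) v
        + l2_inner \<Omega> (\<lambda>x. of_real (w x) * time_avg U n x) v = 0"
    and init0: "U 0 = ritz_projection \<Omega> V u0"
    and init1: "U 1 = ritz_projection \<Omega> V (first_step_data \<Omega> \<tau> w u0 u1)"
  shows "\<forall>m \<le> N - 1. \<forall>n \<le> N - 1. discrete_energy \<Omega> \<tau> w U m = discrete_energy \<Omega> \<tau> w U n"
proof -
  have "open \<Omega>" "bounded \<Omega>"
    using domain by (simp_all add: open_convex_polyhedral_domain bounded_convex_polyhedral_domain)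
  have step: "discrete_energy \<Omega> \<tau> w U n = discrete_energy \<Omega> \<tau> w U (n - 1)"
    if n: "1 \<le> n" "n \<le> N - 1" for n
  proof -
    have mem: "U m \<in> fe_space \<Omega> r (\<T> h)" if "m \<in> {n - 1, n, n + 1}" for m
      using U_in[of m] that n by (auto simp: V_def)
    have "\<exists>B. \<forall>x\<in>\<Omega>. cmod (U m x) \<le> B" if "m \<in> {n - 1, n, n + 1}" for m
      by (rule fe_space_bounded[OF \<open>bounded \<Omega>\<close> mem[OF that]]) blast
    then obtain C where C: "\<And>m x. m \<in> {n - 1, n, n + 1} \<Longrightarrow> x \<in> \<Omega> \<Longrightarrow> cmod (U m x) \<le> C m"
      by metis
    show ?thesis
    proof (rule discrete_energy_step[OF \<open>open \<Omega>\<close> n(1), where B = "Max (C ` {n - 1, n, n + 1})"])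
      show "U m \<in> sobolev 1 \<Omega>" if "m \<in> {n - 1, n, n + 1}" for m
        using mem[OF that] by (simp add: fe_space_def H10_def)
      show "cmod (U m x) \<le> Max (C ` {n - 1, n, n + 1})" if "m \<in> {n - 1, n, n + 1}" "x \<in> \<Omega>" for m x
        using C[OF that] that(1) by (intro order_trans[OF C[OF that] Max_ge]) auto
      show "(\<lambda>x. complex_of_real (w x)) \<in> L2 \<Omega>"
        using potential by (simp add: sobolev_def)
      have "U (n - 1) \<in> V" "U (n + 1) \<in> V"
        using mem by (auto simp: V_def)
      then show "l2_inner \<Omega> (second_diff \<tau> U n) v
        + l2_inner_vec \<Omega> (weak_grad \<Omega> (time_avg U n)) (weak_grad \<Omega> v)
        + \<i> * l2_inner \<Omega> (central_diff \<tau> U n) v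
        + l2_inner \<Omega> (\<lambda>x. of_real ((cmod (U n x))\<^sup>2) * time_avg U n x) v
        + l2_inner \<Omega> (\<lambda>x. of_real (w x) * time_avg U n x) v = 0"
        if "v \<in> {U (n - 1), U (n + 1)}" for v
        using scheme[OF n, of v] that by blast
    qed
  qed
  have "discrete_energy \<Omega> \<tau> w U n = discrete_energy \<Omega> \<tau> w U 0" if "n \<le> N - 1" for n
    using that
  proof (induction n)
    case (Suc n)
    then show ?case using step[of "Suc n"] by simp
  qed simp
  then show ?thesis by metis
qed

end
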